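(* Assume $0\le s<d/2$ and $\mu\in L^\infty\cap\mathcal P(\mathbb R^d)$; if $s=0$, assume $\int_{(\mathbb R^d)^2}|\log|x-y||\,d\mu^{\otimes2}(x,y)<\infty$. Set $a_{N,s}=\log(e+N)$ if $s=0$ and $a_{N,s}=N^{s/d}$ if $0<s<d$. For every $B>0$, there is a constant $C_B(\mu)<\infty$ such that $$\sup_{N\ge1}\ \sup_{0\le\beta\le B}\mathsf K_{N,\beta}(\mu)\le C_B(\mu)$$ and, for all $\beta\ge0$ and $N\ge1$, $$\mathsf K_{N,\beta}(\mu)\le C_B(\mu)\exp\big(C_B(\mu)\,(\beta-B)_+\,a_{N,s}\big).$$ In particular, for every $B_\ast>0$ and $\gamma\in\mathbb R$, there is a constant $C_{B_\ast,\mu}<\infty$ such that, along the temperature scaling $\beta_N=\beta_\ast N^\gamma$, $$\sup_{0\le\beta_\ast\le B_\ast}\log\mathsf K_{N,\beta_\ast N^\gamma}(\mu)\le\begin{cases}C_{B_\ast,\mu},&\gamma\le0,\\ C_{B_\ast,\mu}N^\gamma\log(e+N),&\gamma>0,\ s=0,\\ C_{B_\ast,\mu}N^{\gamma+s/d},&\gamma>0,\ 0<s<d/2,\end{cases}$$ for every $N\ge 1$.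
   Context: Fix a dimension $d\ge1$. $\mathcal P(\mathbb R^d)$ is the set of Borel probability measures; $\mu\in L^\infty\cap\mathcal P(\mathbb R^d)$ means $\mu$ has a bounded Lebesgue density. $\mathsf g(x)=-\log|x|$ if $s=0$ and $\mathsf g(x)=\frac1s|x|^{-s}$ if $0<s<d$. Set $h_\mu(x)=\int\mathsf g(x-y)d\mu(y)$, $I_\mu=\frac12\iint\mathsf g(x-y)d\mu(x)d\mu(y)$, $\tilde{\mathsf g}(x,y)=\mathsf g(x-y)-h_\mu(x)-h_\mu(y)+2I_\mu$. For $X_N=(x_1,\dots,x_N)\in(\mathbb R^d)^N$, $$\mathsf F_N(X_N,\mu)=\frac1{2N^2}\sum_{1\le i\ne j\le N}\tilde{\mathsf g}(x_i,x_j)-\frac1{N^2}\sum_{i=1}^Nh_\mu(x_i)+\frac1NI_\mu,\qquad\mathsf K_{N,\beta}(\mu)=\mathbb E_{\mu^{\otimes N}}\big[e^{-\beta N\mathsf F_N(X_N,\mu)}\big].$$ $(x)_+=\max\{x,0\}$. *)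

theory Defs
  imports "HOL-Probability.Probability"
begin

text \<open>
  The space \<open>\<real>\<^sup>d\<close> is a type \<open>'a :: euclidean_space\<close> with \<open>d = DIM('a) \<ge> 1\<close>; a configuration
  \<open>X\<^sub>N = (x\<^sub>1, \<dots>, x\<^sub>N)\<close> is a function on the index set \<open>{1..N}\<close>.
\<close>

definition bounded_density_prob :: "'a::euclidean_space measure \<Rightarrow> bool" where
  "bounded_density_prob \<mu> \<longleftrightarrow>
     prob_space \<mu> \<and> sets \<mu> = sets borel \<and>
     (\<exists>f M. f \<in> borel_measurable lborel \<and>
            (AE x in lborel. 0 \<le> f x \<and> f x \<le> (M::real)) \<and>
            \<mu> = density lborel (\<lambda>x. ennreal (f x)))"

text \<open>
  At the origin this function takes the value 0 instead of \<open>+\<infinity>\<close>. For a measure with a Lebesgue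
  density the diagonals \<open>{x\<^sub>i = x\<^sub>j}\<close> are null sets, so none of the integrals below depends on it.
\<close>

definition riesz_kernel :: "real \<Rightarrow> 'a::euclidean_space \<Rightarrow> real" where
  "riesz_kernel s x = (if s = 0 then - ln (norm x) else (1 / s) * norm x powr (- s))"

definition potential :: "real \<Rightarrow> 'a::euclidean_space measure \<Rightarrow> 'a \<Rightarrow> real" where
  "potential s \<mu> x = (\<integral>y. riesz_kernel s (x - y) \<partial>\<mu>)"

definition self_energy :: "real \<Rightarrow> 'a::euclidean_space measure \<Rightarrow> real" where
  "self_energy s \<mu> = (1 / 2) * (\<integral>p. riesz_kernel s (fst p - snd p) \<partial>(\<mu> \<Otimes>\<^sub>M \<mu>))"

definition centered_kernel :: "real \<Rightarrow> 'a::euclidean_space measure \<Rightarrow> 'a \<Rightarrow> 'a \<Rightarrow> real" where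
  "centered_kernel s \<mu> x y =
     riesz_kernel s (x - y) - potential s \<mu> x - potential s \<mu> y + 2 * self_energy s \<mu>"

definition modulated_energy ::
  "real \<Rightarrow> nat \<Rightarrow> (nat \<Rightarrow> 'a) \<Rightarrow> 'a::euclidean_space measure \<Rightarrow> real" where
  "modulated_energy s N X \<mu> =
     1 / (2 * (real N)\<^sup>2) * (\<Sum>i\<in>{1..N}. \<Sum>j\<in>{1..N} - {i}. centered_kernel s \<mu> (X i) (X j))
     - 1 / (real N)\<^sup>2 * (\<Sum>i\<in>{1..N}. potential s \<mu> (X i))
     + 1 / real N * self_energy s \<mu>"

text \<open>
  The expectation is a Lebesgue integral with values in \<open>[0, \<infinity>]\<close>, so that an upper bound on it
  includes its finiteness (a divergent Bochner integral would be 0).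
\<close>

definition partition_fun ::
  "real \<Rightarrow> nat \<Rightarrow> real \<Rightarrow> 'a::euclidean_space measure \<Rightarrow> ennreal" where
  "partition_fun s N \<beta> \<mu> =
     (\<integral>\<^sup>+X. ennreal (exp (- \<beta> * real N * modulated_energy s N X \<mu>)) \<partial>(Pi\<^sub>M {1..N} (\<lambda>_. \<mu>)))"

definition log_ennreal :: "ennreal \<Rightarrow> ereal" where
  "log_ennreal x =
     (if x = 0 then - \<infinity> else if x = \<infinity> then \<infinity> else ereal (ln (enn2real x)))"

definition energy_rate :: "nat \<Rightarrow> real \<Rightarrow> nat \<Rightarrow> real" where
  "energy_rate d s N = (if s = 0 then ln (exp 1 + real N) else real N powr (s / real d))"

end

theory Submission
  imports Defs
begin

text \<open>
  Write the kernel as a superposition of Gaussians and cut the superposition at a frequency \<open>T\<close>. The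
  low-frequency part is positive definite after centering and finite on the diagonal, so it contributes
  at most a constant to \<open>- N F\<^sub>N\<close>. The high-frequency part is nonnegative, and its convolution with
  \<open>\<mu>\<close> is \<open>O(T\<^bsup>(s-d)/2\<^esup>)\<close>; taking \<open>T = N\<^bsup>2/d\<^esup>\<close> yields \<open>- N F\<^sub>N \<le> C a\<^sub>N\<close> almost surely.

  For \<open>s < d/2\<close> the rows of the high-frequency kernel moreover have \<open>L\<^sup>2(\<mu>)\<close> norm tending to 0 as
  \<open>T \<rightarrow> \<infinity>\<close>. For a centered kernel \<open>K\<close> that is bounded above and has rows of small \<open>L\<^sup>2\<close> norm,
  \<open>E exp ((1/N) \<Sum>\<^bsub>i<j\<^esub> K(x\<^sub>i, x\<^sub>j))\<close> is bounded uniformly in \<open>N\<close>: using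
  \<open>e\<^bsup>u\<^esup> \<le> 1 + u + u\<^sup>2\<close>, integrating out the last variable replaces \<open>K\<close> by \<open>K + (2/N) K \<circ> K\<close>, again a centered
  kernel, and after \<open>N\<close> steps the constants have changed only by a bounded factor. Fixing \<open>T\<close> large
  depending on \<open>B\<close> thus gives the uniform bound for \<open>\<beta> \<le> B\<close>.
\<close>

section \<open>Exponential moments of centered pair interactions\<close>

text \<open>The obstacle is the sign of the singularity: multiplied by \<open>- \<beta>\<close>, the
  kernel is bounded above but not below, so exponential-moment arguments for bounded kernels do not
  apply. The inequality \<open>exp u \<le> 1 + u + u\<^sup>2\<close> needs only an upper limit on
  \<open>u\<close>, plus second moments. The square of a kernel behaving like
  \<open>norm x powr (- s)\<close> is locally integrable exactly when \<open>2 * s < d\<close>; this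
  is where the restriction on \<open>s\<close> comes from. The iteration closes because the
  composition of a kernel with itself is bounded, whatever the singularity, by the squared row norm
  \<open>q\<close>. A correction of size \<open>2 / N\<close> therefore costs
  \<open>O(1 / N)\<close> per step in the upper bound and in \<open>q\<close>. The starting values
  \<open>1 / 2\<close> and \<open>1 / 256\<close> are chosen so that after \<open>N\<close> such
  losses the limits 1 and \<open>1 / 64\<close> are still respected. For \<open>\<beta> > B\<close>
  the exponent is divided into a share \<open>B\<close>, handled by the moment bound, and the excess
  \<open>\<beta> - B\<close>, handled by the almost sure bound. Only the excess is multiplied by the
  growing rate. The two estimates use different cutoffs, which is harmless because both hold for the
  same energy.\<close>

lemma exp_le_quadratic:
  fixes u :: real
  assumes "u \<le> 1"
  shows "exp u \<le> 1 + u + u\<^sup>2"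
proof (cases "0 \<le> u")
  case True
  then show ?thesis using exp_bound[of u] assms by simp
next
  case False
  \<comment> \<open>Negative \<open>u\<close> may be arbitrarily large in modulus. The claim becomes
    \<open>1 \<le> exp v * (1 - v + v\<^sup>2)\<close>, which already holds with
    \<open>exp v\<close> replaced by its quadratic Taylor polynomial.\<close>
  define v where "v = - u"
  have v: "0 < v" using False by (simp add: v_def)
  have "1 + v + v\<^sup>2 / 2 \<le> exp v" using exp_lower_Taylor_quadratic[of v] v by simp
  moreover have "1 \<le> (1 + v + v\<^sup>2 / 2) * (1 - v + v\<^sup>2)"
  proof -
    have "(1 + v + v\<^sup>2 / 2) * (1 - v + v\<^sup>2) = 1 + v^2/2 + v^3/2 + v^4/2"
      by (simp add: field_simps power2_eq_square power3_eq_cube power4_eq_xxxx)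
    then show ?thesis using v by simp
  qed
  moreover have "0 \<le> 1 - v + v\<^sup>2"
    using zero_le_power2[of "v - 1"] v by (simp add: power2_diff)
  ultimately have "1 \<le> exp v * (1 - v + v\<^sup>2)"
    by (meson dual_order.trans mult_right_mono)
  then have "exp u * 1 \<le> exp u * (exp v * (1 - v + v\<^sup>2))" by (intro mult_left_mono) auto
  also have "\<dots> = 1 + u + u\<^sup>2" by (simp add: v_def flip: mult.assoc exp_add)
  finally show ?thesis by simp
qed

lemma sum_square_split:
  fixes f :: "nat \<Rightarrow> nat \<Rightarrow> real"
  assumes "\<And>i j. i \<in> {1..n} \<Longrightarrow> j \<in> {1..n} \<Longrightarrow> f i j = f j i"
  shows "(\<Sum>i\<in>{1..n}. \<Sum>j\<in>{1..n}. f i j) = 2 * (\<Sum>j\<in>{1..n}. \<Sum>i\<in>{1..<j}. f i j) + (\<Sum>i\<in>{1..n}. f i i)"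
  using assms
proof (induction n)
  case (Suc n)
  have IH: "(\<Sum>i\<in>{1..n}. \<Sum>j\<in>{1..n}. f i j)
      = 2 * (\<Sum>j\<in>{1..n}. \<Sum>i\<in>{1..<j}. f i j) + (\<Sum>i\<in>{1..n}. f i i)"
    by (rule Suc.IH) (use Suc.prems in auto)
  have "(\<Sum>j\<in>{1..n}. f (Suc n) j) = (\<Sum>i\<in>{1..n}. f i (Suc n))"
    by (rule sum.cong) (use Suc.prems in auto)
  then show ?case using IH
    by (simp add: sum.distrib atLeastLessThanSuc_atLeastAtMost)
qed simp

text \<open>Degenerate in the sense of U-statistics: every row has mean zero. A lower bound is
  deliberately absent. The row conditions hold at every point of the space, not almost everywhere,
  so that rows can be taken at arbitrary sample points.\<close>

locale degenerate_kernel = prob_space M for M :: "'a measure" +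
  fixes K :: "'a \<Rightarrow> 'a \<Rightarrow> real" and A q :: real
  assumes measurable_kernel: "case_prod K \<in> borel_measurable (M \<Otimes>\<^sub>M M)"
    and sym: "\<And>x y. x \<in> space M \<Longrightarrow> y \<in> space M \<Longrightarrow> K x y = K y x"
    and upper: "\<And>x y. x \<in> space M \<Longrightarrow> y \<in> space M \<Longrightarrow> K x y \<le> A"
    and sq_integrable: "\<And>x. x \<in> space M \<Longrightarrow> integrable M (\<lambda>y. (K x y)\<^sup>2)"
    and sq_le: "\<And>x. x \<in> space M \<Longrightarrow> (\<integral>y. (K x y)\<^sup>2 \<partial>M) \<le> q"
    and centered: "\<And>x. x \<in> space M \<Longrightarrow> (\<integral>y. K x y \<partial>M) = 0"
begin

lemma q_nonneg: "0 \<le> q"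
proof -
  obtain x where x: "x \<in> space M" using not_empty by blast
  have "0 \<le> (\<integral>y. (K x y)\<^sup>2 \<partial>M)" by simp
  also have "\<dots> \<le> q" by (rule sq_le) fact
  finally show ?thesis .
qed

lemma measurable_section [measurable]:
  "x \<in> space M \<Longrightarrow> K x \<in> borel_measurable M"
  using measurable_Pair2[OF measurable_kernel, of x] by simp

lemma integrable_section: "x \<in> space M \<Longrightarrow> integrable M (K x)"
  by (rule square_integrable_imp_integrable[OF measurable_section sq_integrable])

lemma integrable_mult:
  assumes "x \<in> space M" "y \<in> space M"
  shows "integrable M (\<lambda>z. K x z * K y z)"
proof (rule Bochner_Integration.integrable_bound)
  show "integrable M (\<lambda>z. (K x z)\<^sup>2 + (K y z)\<^sup>2)"
    using sq_integrable assms by auto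
  show "AE z in M. norm (K x z * K y z) \<le> norm ((K x z)\<^sup>2 + (K y z)\<^sup>2)"
  proof (rule AE_I2)
    fix z
    have "2 * (\<bar>K x z\<bar> * \<bar>K y z\<bar>) \<le> (K x z)\<^sup>2 + (K y z)\<^sup>2"
      using sum_squares_bound[of "\<bar>K x z\<bar>" "\<bar>K y z\<bar>"] by simp
    moreover have "0 \<le> \<bar>K x z\<bar> * \<bar>K y z\<bar>" by simp
    ultimately have "\<bar>K x z\<bar> * \<bar>K y z\<bar> \<le> (K x z)\<^sup>2 + (K y z)\<^sup>2" by linarith
    then show "norm (K x z * K y z) \<le> norm ((K x z)\<^sup>2 + (K y z)\<^sup>2)"
      by (simp add: abs_mult)
  qed
qed (use assms in measurable)

text \<open>The square of the integral operator with kernel \<open>K\<close>, written as a Gram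
  matrix of rows. In this form it is symmetric at once, and its double sum over sample points is the
  second moment of a row sum.\<close>

definition comp :: "'a \<Rightarrow> 'a \<Rightarrow> real" where
  "comp x y = (\<integral>z. K x z * K y z \<partial>M)"

lemma comp_sym: "comp x y = comp y x"
  by (simp add: comp_def mult.commute)

lemma measurable_comp: "case_prod comp \<in> borel_measurable (M \<Otimes>\<^sub>M M)"
proof -
  have 1: "(\<lambda>(p, z). K (fst p) z) \<in> borel_measurable ((M \<Otimes>\<^sub>M M) \<Otimes>\<^sub>M M)"
  proof -
    have "(\<lambda>w. case_prod K (fst (fst w), snd w)) \<in> borel_measurable ((M \<Otimes>\<^sub>M M) \<Otimes>\<^sub>M M)"
      by (rule measurable_compose[OF _ measurable_kernel]) measurable
    then show ?thesis by (simp add: case_prod_beta')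
  qed
  have 2: "(\<lambda>(p, z). K (snd p) z) \<in> borel_measurable ((M \<Otimes>\<^sub>M M) \<Otimes>\<^sub>M M)"
  proof -
    have "(\<lambda>w. case_prod K (snd (fst w), snd w)) \<in> borel_measurable ((M \<Otimes>\<^sub>M M) \<Otimes>\<^sub>M M)"
      by (rule measurable_compose[OF _ measurable_kernel]) measurable
    then show ?thesis by (simp add: case_prod_beta')
  qed
  have "(\<lambda>(p, z). K (fst p) z * K (snd p) z) \<in> borel_measurable ((M \<Otimes>\<^sub>M M) \<Otimes>\<^sub>M M)"
    using borel_measurable_times[OF 1 2] by (simp add: case_prod_beta')
  then have "(\<lambda>p. \<integral>z. K (fst p) z * K (snd p) z \<partial>M) \<in> borel_measurable (M \<Otimes>\<^sub>M M)"
    by (rule borel_measurable_lebesgue_integral)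
  then show ?thesis by (simp add: comp_def case_prod_beta')
qed

text \<open>The arithmetic-geometric mean inequality replaces Cauchy-Schwarz: both rows have the
  same bound \<open>q\<close>, so nothing is lost.\<close>

lemma comp_le:
  assumes "x \<in> space M" "y \<in> space M"
  shows "\<bar>comp x y\<bar> \<le> q"
proof -
  have "\<bar>comp x y\<bar> \<le> (\<integral>z. \<bar>K x z * K y z\<bar> \<partial>M)"
    unfolding comp_def by (rule integral_abs_bound)
  also have "\<dots> \<le> (\<integral>z. ((K x z)\<^sup>2 + (K y z)\<^sup>2) / 2 \<partial>M)"
  proof (rule integral_mono)
    show "integrable M (\<lambda>z. \<bar>K x z * K y z\<bar>)" using integrable_mult assms by auto
    show "integrable M (\<lambda>z. ((K x z)\<^sup>2 + (K y z)\<^sup>2) / 2)" using sq_integrable assms by auto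
    fix z
    show "\<bar>K x z * K y z\<bar> \<le> ((K x z)\<^sup>2 + (K y z)\<^sup>2) / 2"
      using sum_squares_bound[of "\<bar>K x z\<bar>" "\<bar>K y z\<bar>"] by (simp add: abs_mult)
  qed
  also have "\<dots> \<le> q" using sq_integrable[OF assms(1)] sq_integrable[OF assms(2)] sq_le[OF assms(1)] sq_le[OF assms(2)]
    by (simp add: field_simps)
  finally show ?thesis .
qed

text \<open>After Fubini the \<open>y\<close>-integral meets only the second factor, and
  \<open>sym\<close> turns it into a row integral, which vanishes. Joint integrability follows from
  the estimate behind \<open>comp_le\<close>, applied to absolute values.\<close>

lemma comp_centered:
  assumes x: "x \<in> space M"
  shows "(\<integral>y. comp x y \<partial>M) = 0"
proof -
  note bounded_integrable = integrable_const_bound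
  interpret pair_prob_space M M ..
  have meas: "(\<lambda>(y, z). K x z * K y z) \<in> borel_measurable (M \<Otimes>\<^sub>M M)"
  proof -
    have "(\<lambda>p. K x (snd p)) \<in> borel_measurable (M \<Otimes>\<^sub>M M)"
      using measurable_section[OF x] by measurable
    from borel_measurable_times[OF this measurable_kernel]
    show ?thesis by (simp add: case_prod_beta')
  qed
  have int: "integrable (M \<Otimes>\<^sub>M M) (\<lambda>(y, z). K x z * K y z)"
  proof (rule Fubini_integrable[OF meas])
    show "AE y in M. integrable M (\<lambda>z. case (y, z) of (y, z) \<Rightarrow> K x z * K y z)"
      using integrable_mult[OF x] by (intro AE_I2) simp
    show "integrable M (\<lambda>y. \<integral>z. norm (case (y, z) of (y, z) \<Rightarrow> K x z * K y z) \<partial>M)"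
    proof (rule bounded_integrable)
      show "AE y in M. norm (\<integral>z. norm (case (y, z) of (y, z) \<Rightarrow> K x z * K y z) \<partial>M) \<le> q"
      proof (rule AE_I2)
        fix y assume y: "y \<in> space M"
        have "(\<integral>z. \<bar>K x z * K y z\<bar> \<partial>M) \<le> (\<integral>z. ((K x z)\<^sup>2 + (K y z)\<^sup>2) / 2 \<partial>M)"
        proof (rule integral_mono)
          show "integrable M (\<lambda>z. \<bar>K x z * K y z\<bar>)" using integrable_mult[OF x y] by auto
          show "integrable M (\<lambda>z. ((K x z)\<^sup>2 + (K y z)\<^sup>2) / 2)" using sq_integrable x y by auto
          fix z
          show "\<bar>K x z * K y z\<bar> \<le> ((K x z)\<^sup>2 + (K y z)\<^sup>2) / 2"
            using sum_squares_bound[of "\<bar>K x z\<bar>" "\<bar>K y z\<bar>"] by (simp add: abs_mult)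
        qed
        also have "\<dots> \<le> q" using sq_integrable[OF x] sq_integrable[OF y] sq_le[OF x] sq_le[OF y]
          by (simp add: field_simps)
        finally show "norm (\<integral>z. norm (case (y, z) of (y, z) \<Rightarrow> K x z * K y z) \<partial>M) \<le> q"
          by simp
      qed
      have "(\<lambda>(y, z). \<bar>K x z * K y z\<bar>) \<in> borel_measurable (M \<Otimes>\<^sub>M M)"
        using borel_measurable_abs[OF meas] by (simp add: case_prod_beta')
      then show "(\<lambda>y. \<integral>z. norm (case (y, z) of (y, z) \<Rightarrow> K x z * K y z) \<partial>M) \<in> borel_measurable M"
        by (simp add: borel_measurable_lebesgue_integral)
    qed
  qed
  have "(\<integral>y. comp x y \<partial>M) = (\<integral>z. (\<integral>y. K x z * K y z \<partial>M) \<partial>M)"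
    unfolding comp_def using Fubini_integral[OF int] by simp
  also have "\<dots> = (\<integral>z. 0 \<partial>M)"
  proof (rule Bochner_Integration.integral_cong[OF refl])
    fix z assume z: "z \<in> space M"
    have "(\<integral>y. K x z * K y z \<partial>M) = K x z * (\<integral>y. K y z \<partial>M)" by simp
    also have "(\<integral>y. K y z \<partial>M) = (\<integral>y. K z y \<partial>M)"
      by (rule Bochner_Integration.integral_cong[OF refl]) (use sym z in auto)
    finally show "(\<integral>y. K x z * K y z \<partial>M) = 0" using centered[OF z] by simp
  qed
  finally show ?thesis by simp
qed

lemma integrable_comp:
  assumes "x \<in> space M"
  shows "integrable M (comp x)"
  using measurable_Pair2[OF measurable_comp assms] comp_le[OF assms]
  by (intro integrable_const_bound[where B=q]) (auto intro!: AE_I2)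

text \<open>A Young inequality tuned to \<open>q\<close> near \<open>1 / 64\<close>: it keeps the
  bound polynomial in \<open>q\<close>, giving \<open>5 / 32\<close> there, where Cauchy-Schwarz
  would give \<open>1 / 8\<close>.\<close>

lemma integral_abs_section_le:
  assumes x: "x \<in> space M"
  shows "(\<integral>y. \<bar>K x y\<bar> \<partial>M) \<le> 2 * q + 1 / 8"
proof -
  have "(\<integral>y. \<bar>K x y\<bar> \<partial>M) \<le> (\<integral>y. 2 * (K x y)\<^sup>2 + 1 / 8 \<partial>M)"
  proof (rule integral_mono)
    show "integrable M (\<lambda>y. 2 * (K x y)\<^sup>2 + 1 / 8)" using sq_integrable[OF x] by auto
    show "integrable M (\<lambda>y. \<bar>K x y\<bar>)" using integrable_section[OF x] by auto
    fix y
    have "0 \<le> 2 * (\<bar>K x y\<bar> - 1 / 4)\<^sup>2" by simp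
    then show "\<bar>K x y\<bar> \<le> 2 * (K x y)\<^sup>2 + 1 / 8"
      by (simp add: power2_diff field_simps)
  qed
  also have "\<dots> \<le> 2 * q + 1 / 8" using sq_integrable[OF x] sq_le[OF x]
    by (simp add: prob_space)
  finally show ?thesis .
qed

text \<open>Integrating out one variable adds \<open>2 / m * comp\<close> to the kernel. Both constants degrade only
  by \<open>O(1 / m)\<close>, so they stay under control over all \<open>n \<le> m\<close> steps.\<close>

lemma degenerate_kernel_step:
  fixes m :: real
  assumes m: "1 \<le> m" and q: "q \<le> 1 / 64"
  shows "degenerate_kernel M (\<lambda>x y. K x y + 2 / m * comp x y) (A + 1 / (32 * m)) (q + 3 / (256 * m))"
proof
  show "(\<lambda>(x, y). K x y + 2 / m * comp x y) \<in> borel_measurable (M \<Otimes>\<^sub>M M)"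
    using borel_measurable_add[OF measurable_kernel borel_measurable_times[OF borel_measurable_const[of "2 / m"] measurable_comp]]
    by (simp add: case_prod_beta')
  fix x assume x: "x \<in> space M"
  note [measurable] = measurable_section[OF x] borel_measurable_integrable[OF integrable_comp[OF x]]
  show "(\<integral>y. K x y + 2 / m * comp x y \<partial>M) = 0"
    using centered[OF x] comp_centered[OF x] integrable_section[OF x] integrable_comp[OF x] by simp
  have i1: "integrable M (\<lambda>y. K x y * comp x y)"
  proof (rule Bochner_Integration.integrable_bound)
    show "integrable M (\<lambda>y. q * K x y)" using integrable_section[OF x] by simp
    show "AE y in M. norm (K x y * comp x y) \<le> norm (q * K x y)"
      using comp_le[OF x] q_nonneg by (intro AE_I2) (auto simp: abs_mult mult.commute[of q] intro!: mult_left_mono)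
  qed simp
  have c2: "(comp x y)\<^sup>2 \<le> q\<^sup>2" if "y \<in> space M" for y
    using power_mono[OF comp_le[OF x that], of 2] by simp
  have i2: "integrable M (\<lambda>y. (comp x y)\<^sup>2)"
    by (rule integrable_const_bound[where B="q\<^sup>2"]) (use c2 in \<open>auto intro!: AE_I2\<close>)
  have eq: "(K x y + 2 / m * comp x y)\<^sup>2 = (K x y)\<^sup>2 + 4 / m * (K x y * comp x y) + 4 / m\<^sup>2 * (comp x y)\<^sup>2" for y
    by (simp add: power2_eq_square algebra_simps)
  show "integrable M (\<lambda>y. (K x y + 2 / m * comp x y)\<^sup>2)"
    unfolding eq using sq_integrable[OF x] i1 i2 by auto
  have "(\<integral>y. (K x y + 2 / m * comp x y)\<^sup>2 \<partial>M)
      = (\<integral>y. (K x y)\<^sup>2 \<partial>M) + 4 / m * (\<integral>y. K x y * comp x y \<partial>M) + 4 / m\<^sup>2 * (\<integral>y. (comp x y)\<^sup>2 \<partial>M)"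
    unfolding eq using sq_integrable[OF x] i1 i2 by simp
  also have "\<dots> \<le> q + 4 / m * (q * (2 * q + 1 / 8)) + 4 / m\<^sup>2 * q\<^sup>2"
  proof (intro add_mono mult_left_mono)
    show "(\<integral>y. (K x y)\<^sup>2 \<partial>M) \<le> q" by (rule sq_le[OF x])
    have "(\<integral>y. K x y * comp x y \<partial>M) \<le> (\<integral>y. q * \<bar>K x y\<bar> \<partial>M)"
    proof (rule integral_mono[OF i1])
      show "integrable M (\<lambda>y. q * \<bar>K x y\<bar>)" using integrable_section[OF x] by simp
      fix y assume y: "y \<in> space M"
      have "K x y * comp x y \<le> \<bar>K x y\<bar> * \<bar>comp x y\<bar>" by (metis abs_ge_self abs_mult)
      also have "\<dots> \<le> \<bar>K x y\<bar> * q" using comp_le[OF x y] by (intro mult_left_mono) auto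
      finally show "K x y * comp x y \<le> q * \<bar>K x y\<bar>" by (simp add: mult.commute)
    qed
    also have "\<dots> \<le> q * (2 * q + 1 / 8)"
      using integral_abs_section_le[OF x] q_nonneg by (auto intro!: mult_left_mono)
    finally show "(\<integral>y. K x y * comp x y \<partial>M) \<le> q * (2 * q + 1 / 8)" .
    have "(\<integral>y. (comp x y)\<^sup>2 \<partial>M) \<le> (\<integral>y. q\<^sup>2 \<partial>M)"
      by (rule integral_mono[OF i2]) (use c2 in auto)
    then show "(\<integral>y. (comp x y)\<^sup>2 \<partial>M) \<le> q\<^sup>2" by (simp add: prob_space)
  qed (use m in auto)
  \<comment> \<open>For \<open>q \<le> 1 / 64\<close> the two corrections are at most
    \<open>5 / 512\<close> and \<open>1 / 1024\<close>, each divided by \<open>m\<close>; together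
    \<open>11 / 1024\<close>, just below \<open>3 / 256\<close>.\<close>
  also have "\<dots> \<le> q + 3 / (256 * m)"
  proof -
    have "q * (2 * q + 1 / 8) \<le> (1 / 64) * (2 * (1 / 64) + 1 / 8)"
      using q q_nonneg by (intro mult_mono) auto
    then have "4 / m * (q * (2 * q + 1 / 8)) \<le> 4 / m * ((1 / 64) * (2 * (1 / 64) + 1 / 8))"
      using m by (intro mult_left_mono) auto
    moreover have "4 / m\<^sup>2 * q\<^sup>2 \<le> 4 / m * (1 / 64)\<^sup>2"
      using q q_nonneg m by (intro mult_mono power_mono) (auto simp: field_simps power2_eq_square)
    moreover have "4 / m * ((1 / 64) * (2 * (1 / 64) + 1 / 8)) + 4 / m * (1 / 64)\<^sup>2 \<le> 3 / (256 * m)"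
      using m by (simp add: field_simps power2_eq_square)
    ultimately show ?thesis by linarith
  qed
  finally show "(\<integral>y. (K x y + 2 / m * comp x y)\<^sup>2 \<partial>M) \<le> q + 3 / (256 * m)" .
  fix y assume y: "y \<in> space M"
  show "K x y + 2 / m * comp x y = K y x + 2 / m * comp y x"
    using sym[OF x y] comp_sym[of x y] by simp
  have "2 / m * comp x y \<le> 2 / m * (1 / 64)"
    using comp_le[OF x y] q m by (intro mult_left_mono) auto
  then show "K x y + 2 / m * comp x y \<le> A + 1 / (32 * m)"
    using upper[OF x y] by simp
qed

section \<open>Integrating out the particles one at a time\<close>

lemma measurable_pair_energy:
  "(\<lambda>X. \<Sum>j\<in>{1..n}. \<Sum>i\<in>{1..<j}. K (X i) (X j)) \<in> borel_measurable (Pi\<^sub>M {1..n::nat} (\<lambda>_. M))"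
proof (intro borel_measurable_sum)
  fix j i assume "j \<in> {1..n}" "i \<in> {1..<j}"
  then have "(\<lambda>X. case_prod K (X i, X j)) \<in> borel_measurable (Pi\<^sub>M {1..n} (\<lambda>_. M))"
    by (intro measurable_compose[OF _ measurable_kernel]) auto
  then show "(\<lambda>X. K (X i) (X j)) \<in> borel_measurable (Pi\<^sub>M {1..n} (\<lambda>_. M))" by simp
qed

text \<open>Second-order expansion of the exponential of a row sum. The linear term vanishes by
  centering; the quadratic term is the double sum of \<open>comp\<close>, whose off-diagonal part
  becomes a pair energy of the remaining points, while its diagonal costs at most
  \<open>q / m\<close>. The bounds \<open>n \<le> m\<close> and \<open>A \<le> 1\<close> make
  \<open>exp_le_quadratic\<close> applicable, and \<open>1 + v \<le> exp v\<close> finally returns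
  to exponential form.\<close>

lemma nn_integral_exp_le:
  fixes x :: "nat \<Rightarrow> 'a" and m :: real
  assumes x: "\<And>i. i \<in> {1..n} \<Longrightarrow> x i \<in> space M" and m: "1 \<le> m" "real n \<le> m"
    and A: "A \<le> 1"
  shows "(\<integral>\<^sup>+y. ennreal (exp ((\<Sum>i\<in>{1..n}. K (x i) y) / m)) \<partial>M)
    \<le> ennreal (exp (2 / m * (\<Sum>j\<in>{1..n}. \<Sum>i\<in>{1..<j}. comp (x i) (x j)) / m + q / m))"
proof -
  define S where "S = (\<lambda>y. \<Sum>i\<in>{1..n}. K (x i) y)"
  have sq: "(S y)\<^sup>2 = (\<Sum>i\<in>{1..n}. \<Sum>j\<in>{1..n}. K (x i) y * K (x j) y)" for y
    by (simp add: S_def power2_eq_square sum_product)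
  have S1: "integrable M S" unfolding S_def
    by (intro Bochner_Integration.integrable_sum integrable_section x)
  have S2: "integrable M (\<lambda>y. (S y)\<^sup>2)" unfolding sq
    by (intro Bochner_Integration.integrable_sum integrable_mult x)
  have S0: "(\<integral>y. S y \<partial>M) = 0" unfolding S_def
    by (subst Bochner_Integration.integral_sum) (auto simp: integrable_section x centered)
  have "(\<integral>y. (S y)\<^sup>2 \<partial>M) = (\<Sum>i\<in>{1..n}. \<Sum>j\<in>{1..n}. comp (x i) (x j))"
    unfolding sq comp_def
    by (subst Bochner_Integration.integral_sum
        , (intro Bochner_Integration.integrable_sum integrable_mult x; assumption)
        , intro sum.cong[OF refl] Bochner_Integration.integral_sum integrable_mult x; assumption)
  also have "\<dots> = 2 * (\<Sum>j\<in>{1..n}. \<Sum>i\<in>{1..<j}. comp (x i) (x j)) + (\<Sum>i\<in>{1..n}. comp (x i) (x i))"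
    by (rule sum_square_split) (rule comp_sym)
  also have "(\<Sum>i\<in>{1..n}. comp (x i) (x i)) \<le> (\<Sum>i\<in>{1..n}. q)"
    by (rule sum_mono) (use comp_le[OF x x] in \<open>auto simp: abs_le_iff\<close>)
  also have "\<dots> \<le> m * q" using m q_nonneg by (simp add: mult_right_mono)
  finally have le: "(\<integral>y. (S y)\<^sup>2 \<partial>M) / m\<^sup>2
      \<le> 2 / m * (\<Sum>j\<in>{1..n}. \<Sum>i\<in>{1..<j}. comp (x i) (x j)) / m + q / m"
    using m by (simp add: field_simps power2_eq_square)
  have S_le: "S y / m \<le> 1" if y: "y \<in> space M" for y
  proof -
    have "S y \<le> (\<Sum>i\<in>{1..n}. 1)" unfolding S_def
      by (rule sum_mono) (use upper[OF x y] A in force)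
    then show ?thesis using m by simp
  qed
  have "(\<integral>\<^sup>+y. ennreal (exp (S y / m)) \<partial>M) \<le> (\<integral>\<^sup>+y. ennreal (1 + S y / m + (S y / m)\<^sup>2) \<partial>M)"
    by (intro nn_integral_mono ennreal_leI exp_le_quadratic S_le)
  also have "\<dots> = ennreal (\<integral>y. 1 + S y / m + (S y / m)\<^sup>2 \<partial>M)"
  proof (rule nn_integral_eq_integral)
    show "integrable M (\<lambda>y. 1 + S y / m + (S y / m)\<^sup>2)"
      using S1 S2 by (auto simp: power_divide)
    show "AE y in M. 0 \<le> 1 + S y / m + (S y / m)\<^sup>2"
    proof (rule AE_I2)
      fix y assume y: "y \<in> space M"
      have "0 \<le> exp (S y / m)" by simp
      also note exp_le_quadratic[OF S_le[OF y]]
      finally show "0 \<le> 1 + S y / m + (S y / m)\<^sup>2" .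
    qed
  qed
  also have "(\<integral>y. 1 + S y / m + (S y / m)\<^sup>2 \<partial>M) = 1 + (\<integral>y. (S y)\<^sup>2 \<partial>M) / m\<^sup>2"
    using S1 S2 S0 by (simp add: power_divide prob_space)
  also have "ennreal \<dots> \<le> ennreal (exp (2 / m * (\<Sum>j\<in>{1..n}. \<Sum>i\<in>{1..<j}. comp (x i) (x j)) / m + q / m))"
  proof (rule ennreal_leI)
    have "1 + (\<integral>y. (S y)\<^sup>2 \<partial>M) / m\<^sup>2 \<le> exp ((\<integral>y. (S y)\<^sup>2 \<partial>M) / m\<^sup>2)" by (rule exp_ge_add_one_self)
    also have "\<dots> \<le> exp (2 / m * (\<Sum>j\<in>{1..n}. \<Sum>i\<in>{1..<j}. comp (x i) (x j)) / m + q / m)"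
      using le by simp
    finally show "1 + (\<integral>y. (S y)\<^sup>2 \<partial>M) / m\<^sup>2
      \<le> exp (2 / m * (\<Sum>j\<in>{1..n}. \<Sum>i\<in>{1..<j}. comp (x i) (x j)) / m + q / m)" .
  qed
  finally show ?thesis unfolding S_def .
qed

end

text \<open>The normalization \<open>m\<close> stays fixed while \<open>n\<close> counts the
  variables still to be integrated out. The hypotheses on \<open>A\<close> and \<open>q\<close>
  reserve room for \<open>n\<close> further increments of \<open>degenerate_kernel_step\<close>; the
  kernel must be arbitrary in the induction because it changes at every step. Each step contributes
  a factor of at most \<open>exp (1 / m)\<close>.\<close>

lemma degenerate_exp_moment_aux:
  fixes m :: real
  assumes "degenerate_kernel M K A q" and m: "1 \<le> m" "real n \<le> m"
    and "A \<le> 1 - real n / (32 * m)" and "q \<le> 1 / 64 - real n * (3 / (256 * m))"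
  shows "(\<integral>\<^sup>+X. ennreal (exp ((\<Sum>j\<in>{1..n}. \<Sum>i\<in>{1..<j}. K (X i) (X j)) / m)) \<partial>(Pi\<^sub>M {1..n} (\<lambda>_. M)))
    \<le> ennreal (exp (real n / m))"
  using assms
proof (induction n arbitrary: K A q)
  case 0
  interpret degenerate_kernel M K A q by fact
  interpret P: product_sigma_finite "\<lambda>_::nat. M" ..
  show ?case by (simp add: P.nn_integral_empty PiM_empty)
next
  case (Suc n)
  interpret degenerate_kernel M K A q by fact
  interpret P: product_sigma_finite "\<lambda>_::nat. M" ..
  let ?K' = "\<lambda>x y. K x y + 2 / m * comp x y"
  let ?W = "\<lambda>X. (\<Sum>j\<in>{1..n}. \<Sum>i\<in>{1..<j}. K (X i) (X j)) :: real"
  let ?W' = "\<lambda>X. (\<Sum>j\<in>{1..n}. \<Sum>i\<in>{1..<j}. ?K' (X i) (X j)) :: real"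
  have pos: "0 \<le> real (Suc n) / (32 * m)" "0 \<le> real (Suc n) * (3 / (256 * m))" using m by auto
  have q64: "q \<le> 1 / 64" and A1: "A \<le> 1" using Suc.prems pos by linarith+
  have q1: "q \<le> 1" using q64 by simp
  have deg: "degenerate_kernel M ?K' (A + 1 / (32 * m)) (q + 3 / (256 * m))"
    by (rule degenerate_kernel_step[OF m(1) q64])
  have IH: "(\<integral>\<^sup>+X. ennreal (exp (?W' X / m)) \<partial>(Pi\<^sub>M {1..n} (\<lambda>_. M))) \<le> ennreal (exp (real n / m))"
  proof (rule Suc.IH[OF deg m(1)])
    show "A + 1 / (32 * m) \<le> 1 - real n / (32 * m)" "q + 3 / (256 * m) \<le> 1 / 64 - real n * (3 / (256 * m))"
      using Suc.prems by (simp_all add: add_divide_distrib ring_distribs)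
  qed (use Suc.prems in simp)
  have ins: "{1..Suc n} = insert (Suc n) {1..n}" by auto
  have meas: "(\<lambda>X. ennreal (exp ((\<Sum>j\<in>{1..Suc n}. \<Sum>i\<in>{1..<j}. K (X i) (X j)) / m)))
      \<in> borel_measurable (Pi\<^sub>M {1..Suc n} (\<lambda>_. M))"
    using measurable_pair_energy[of "Suc n"] by measurable
  have "(\<integral>\<^sup>+X. ennreal (exp ((\<Sum>j\<in>{1..Suc n}. \<Sum>i\<in>{1..<j}. K (X i) (X j)) / m)) \<partial>(Pi\<^sub>M {1..Suc n} (\<lambda>_. M)))
    = (\<integral>\<^sup>+X. \<integral>\<^sup>+y. ennreal (exp ((\<Sum>j\<in>{1..Suc n}. \<Sum>i\<in>{1..<j}. K ((X(Suc n := y)) i) ((X(Suc n := y)) j)) / m)) \<partial>M \<partial>(Pi\<^sub>M {1..n} (\<lambda>_. M)))"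
    unfolding ins by (rule P.product_nn_integral_insert[OF _ _ meas[unfolded ins]]) auto
  also have "\<dots> = (\<integral>\<^sup>+X. \<integral>\<^sup>+y. ennreal (exp (?W X / m)) * ennreal (exp ((\<Sum>i\<in>{1..n}. K (X i) y) / m)) \<partial>M \<partial>(Pi\<^sub>M {1..n} (\<lambda>_. M)))"
  proof (intro nn_integral_cong)
    fix X y
    have "(\<Sum>j\<in>{1..Suc n}. \<Sum>i\<in>{1..<j}. K ((X(Suc n := y)) i) ((X(Suc n := y)) j))
      = ?W X + (\<Sum>i\<in>{1..n}. K (X i) y)"
      by (auto simp: atLeastLessThanSuc_atLeastAtMost intro!: sum.cong arg_cong2[of _ _ _ _ "(+)"])
    then show "ennreal (exp ((\<Sum>j\<in>{1..Suc n}. \<Sum>i\<in>{1..<j}. K ((X(Suc n := y)) i) ((X(Suc n := y)) j)) / m))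
      = ennreal (exp (?W X / m)) * ennreal (exp ((\<Sum>i\<in>{1..n}. K (X i) y) / m))"
      by (simp add: add_divide_distrib exp_add ennreal_mult)
  qed
  also have "\<dots> \<le> (\<integral>\<^sup>+X. ennreal (exp (1 / m)) * ennreal (exp (?W' X / m)) \<partial>(Pi\<^sub>M {1..n} (\<lambda>_. M)))"
  proof (rule nn_integral_mono)
    fix X assume "X \<in> space (Pi\<^sub>M {1..n} (\<lambda>_. M))"
    then have X: "X i \<in> space M" if "i \<in> {1..n}" for i using that by (auto simp: space_PiM PiE_def Pi_def)
    have [measurable]: "(\<lambda>y. \<Sum>i\<in>{1..n}. K (X i) y) \<in> borel_measurable M"
      by (intro borel_measurable_sum measurable_section X)
    have "(\<integral>\<^sup>+y. ennreal (exp (?W X / m)) * ennreal (exp ((\<Sum>i\<in>{1..n}. K (X i) y) / m)) \<partial>M)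
      = ennreal (exp (?W X / m)) * (\<integral>\<^sup>+y. ennreal (exp ((\<Sum>i\<in>{1..n}. K (X i) y) / m)) \<partial>M)"
      by (rule nn_integral_cmult) measurable
    also have "\<dots> \<le> ennreal (exp (?W X / m))
        * ennreal (exp (2 / m * (\<Sum>j\<in>{1..n}. \<Sum>i\<in>{1..<j}. comp (X i) (X j)) / m + q / m))"
      by (intro mult_left_mono nn_integral_exp_le X m(1) A1) (use m Suc.prems in auto)
    also have "\<dots> = ennreal (exp (q / m + ?W' X / m))"
      by (simp add: sum.distrib sum_distrib_left add_divide_distrib flip: ennreal_mult exp_add)
    also have "\<dots> \<le> ennreal (exp (1 / m + ?W' X / m))"
      using q1 m by (intro ennreal_leI) (simp add: divide_right_mono)
    finally show "(\<integral>\<^sup>+y. ennreal (exp (?W X / m)) * ennreal (exp ((\<Sum>i\<in>{1..n}. K (X i) y) / m)) \<partial>M)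
      \<le> ennreal (exp (1 / m)) * ennreal (exp (?W' X / m))" by (simp add: exp_add ennreal_mult)
  qed
  also have "\<dots> = ennreal (exp (1 / m)) * (\<integral>\<^sup>+X. ennreal (exp (?W' X / m)) \<partial>(Pi\<^sub>M {1..n} (\<lambda>_. M)))"
  proof (rule nn_integral_cmult)
    interpret K': degenerate_kernel M ?K' "A + 1 / (32 * m)" "q + 3 / (256 * m)" by (rule deg)
    show "(\<lambda>X. ennreal (exp (?W' X / m))) \<in> borel_measurable (Pi\<^sub>M {1..n} (\<lambda>_. M))"
      using K'.measurable_pair_energy[of n] by measurable
  qed
  also have "\<dots> \<le> ennreal (exp (1 / m)) * ennreal (exp (real n / m))"
    by (intro mult_left_mono IH) auto
  also have "\<dots> = ennreal (exp (real (Suc n) / m))"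
    by (simp add: add_divide_distrib flip: ennreal_mult exp_add)
  finally show ?case .
qed

text \<open>With \<open>m = n\<close> the reserves of the induction are \<open>1 - 1 / 32\<close>
  for \<open>A\<close> and \<open>1 / 64 - 3 / 256 = 1 / 256\<close> for \<open>q\<close>. The value
  \<open>1 / 2\<close> is a convenient number below the first.\<close>

theorem degenerate_exp_moment:
  assumes "degenerate_kernel M K (1 / 2) (1 / 256)" and n: "1 \<le> n"
  shows "(\<integral>\<^sup>+X. ennreal (exp ((\<Sum>j\<in>{1..n}. \<Sum>i\<in>{1..<j}. K (X i) (X j)) / real n)) \<partial>(Pi\<^sub>M {1..n} (\<lambda>_. M)))
    \<le> ennreal (exp 1)"
  using degenerate_exp_moment_aux[OF assms(1), of "real n" n] n by simp

section \<open>Positive definiteness of Gaussians\<close>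

definition gauss :: "real \<Rightarrow> 'a::euclidean_space \<Rightarrow> real" where
  "gauss t x = exp (- t * (norm x)\<^sup>2)"

lemma gauss_nonneg [simp]: "0 \<le> gauss t x"
  by (simp add: gauss_def)

lemma gauss_le_1: "0 \<le> t \<Longrightarrow> gauss t x \<le> 1"
  by (simp add: gauss_def)

lemma gauss_minus_commute: "gauss t (x - y) = gauss t (y - x)"
  by (simp add: gauss_def norm_minus_commute)

lemma measurable_gauss [measurable]: "gauss t \<in> borel_measurable borel"
  unfolding gauss_def by measurable

lemma nn_integral_gauss_real:
  fixes t :: real
  assumes t: "0 < t"
  shows "(\<integral>\<^sup>+x. ennreal (exp (- t * x\<^sup>2)) \<partial>lborel) = ennreal (sqrt (pi / t))"
proof -
  define \<sigma> where "\<sigma> = sqrt (1 / (2 * t))"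
  have \<sigma>: "0 < \<sigma>" "\<sigma>\<^sup>2 = 1 / (2 * t)" using t by (simp_all add: \<sigma>_def)
  have eq: "exp (- t * x\<^sup>2) = sqrt (pi / t) * normal_density 0 \<sigma> x" for x
    unfolding normal_density_def \<sigma> using t by (simp add: field_simps real_sqrt_divide)
  have "(\<integral>\<^sup>+x. ennreal (exp (- t * x\<^sup>2)) \<partial>lborel)
      = (\<integral>\<^sup>+x. ennreal (sqrt (pi / t)) * ennreal (normal_density 0 \<sigma> x) \<partial>lborel)"
    unfolding eq using t by (simp add: ennreal_mult)
  also have "\<dots> = ennreal (sqrt (pi / t)) * (\<integral>\<^sup>+x. ennreal (normal_density 0 \<sigma> x) \<partial>lborel)"
    by (rule nn_integral_cmult) measurable
  also have "(\<integral>\<^sup>+x. ennreal (normal_density 0 \<sigma> x) \<partial>lborel) = 1"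
    using integrable_normal_density[OF \<sigma>(1)] integral_normal_density[OF \<sigma>(1)]
    by (subst nn_integral_eq_integral) auto
  finally show ?thesis by simp
qed

lemma nn_integral_gauss:
  assumes t: "0 < t"
  shows "(\<integral>\<^sup>+x. ennreal (gauss t (x::'a::euclidean_space)) \<partial>lborel) = ennreal ((pi / t) powr (real DIM('a) / 2))"
proof -
  have "gauss t x = (\<Prod>b\<in>Basis. exp (- t * (x \<bullet> b)\<^sup>2))" for x :: 'a
    unfolding gauss_def norm_eq_sqrt_inner euclidean_inner[of x x]
    by (subst real_sqrt_pow2)
      (auto simp: sum_nonneg power2_eq_square sum_distrib_left exp_sum simp flip: sum_negf)
  then have "(\<integral>\<^sup>+x. ennreal (gauss t (x::'a)) \<partial>lborel)
      = (\<integral>\<^sup>+x. (\<Prod>b\<in>Basis. ennreal (exp (- t * ((x::'a) \<bullet> b)\<^sup>2))) \<partial>lborel)"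
    by (simp add: prod_ennreal)
  also have "\<dots> = (\<Prod>b\<in>(Basis::'a set). \<integral>\<^sup>+x. ennreal (exp (- t * x\<^sup>2)) \<partial>lborel)"
    by (rule nn_integral_lborel_prod) auto
  also have "\<dots> = ennreal (sqrt (pi / t) ^ DIM('a))"
    unfolding nn_integral_gauss_real[OF t] using t by (simp add: ennreal_power)
  also have "sqrt (pi / t) ^ DIM('a) = (pi / t) powr (real DIM('a) / 2)"
    using t by (simp add: powr_half_sqrt[symmetric] powr_powr flip: powr_realpow)
  finally show ?thesis .
qed

lemma nn_integral_lborel_shift:
  fixes f :: "'a::euclidean_space \<Rightarrow> ennreal"
  assumes [measurable]: "f \<in> borel_measurable borel"
  shows "(\<integral>\<^sup>+x. f (x - a) \<partial>lborel) = (\<integral>\<^sup>+x. f x \<partial>lborel)"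
proof -
  have "(\<integral>\<^sup>+x. f x \<partial>lborel) = (\<integral>\<^sup>+x. f x \<partial>(distr lborel borel ((+) (- a))))"
    by (simp add: lborel_distr_plus)
  also have "\<dots> = (\<integral>\<^sup>+x. f (x - a) \<partial>lborel)" by (subst nn_integral_distr) auto
  finally show ?thesis ..
qed

text \<open>The parallelogram law about the midpoint separates \<open>z\<close> from
  \<open>x - y\<close>. Hence \<open>gauss t\<close> is, up to a constant, the convolution of
  \<open>gauss (2 * t)\<close> with itself, which gives positive definiteness without Fourier
  transforms.\<close>

lemma nn_integral_gauss_mult:
  fixes x y :: "'a::euclidean_space"
  assumes t: "0 < t"
  shows "(\<integral>\<^sup>+z. ennreal (gauss (2 * t) (z - x) * gauss (2 * t) (z - y)) \<partial>lborel)
    = ennreal ((pi / (4 * t)) powr (real DIM('a) / 2) * gauss t (x - y))"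
proof -
  define m where "m = (1 / 2) *\<^sub>R (x + y)"
  have eq: "gauss (2 * t) (z - x) * gauss (2 * t) (z - y) = gauss t (x - y) * gauss (4 * t) (z - m)" for z
  proof -
    have "(norm (z - x))\<^sup>2 + (norm (z - y))\<^sup>2 = 2 * (norm (z - m))\<^sup>2 + (norm (x - y))\<^sup>2 / 2"
      unfolding m_def power2_norm_eq_inner
      by (simp add: inner_diff_left inner_diff_right inner_add_left inner_add_right inner_commute field_simps)
    then have "2 * t * ((norm (z - x))\<^sup>2 + (norm (z - y))\<^sup>2)
        = 2 * t * (2 * (norm (z - m))\<^sup>2 + (norm (x - y))\<^sup>2 / 2)" by simp
    then have "- (2 * t) * (norm (z - x))\<^sup>2 + - (2 * t) * (norm (z - y))\<^sup>2
        = - t * (norm (x - y))\<^sup>2 + - (4 * t) * (norm (z - m))\<^sup>2"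
      by (simp add: algebra_simps)
    then show ?thesis unfolding gauss_def by (simp flip: exp_add)
  qed
  have "(\<integral>\<^sup>+z. ennreal (gauss (2 * t) (z - x) * gauss (2 * t) (z - y)) \<partial>lborel)
    = (\<integral>\<^sup>+z. ennreal (gauss t (x - y)) * ennreal (gauss (4 * t) (z - m)) \<partial>lborel)"
    by (simp add: eq ennreal_mult)
  also have "\<dots> = ennreal (gauss t (x - y)) * (\<integral>\<^sup>+z. ennreal (gauss (4 * t) (z - m)) \<partial>lborel)"
    by (rule nn_integral_cmult) measurable
  also have "(\<integral>\<^sup>+z. ennreal (gauss (4 * t) (z - m)) \<partial>lborel) = ennreal ((pi / (4 * t)) powr (real DIM('a) / 2))"
    using nn_integral_lborel_shift[of "\<lambda>z. ennreal (gauss (4 * t) z)" m] nn_integral_gauss[of "4 * t", where 'a='a] t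
    by simp
  finally show ?thesis by (simp add: mult.commute ennreal_mult)
qed

definition gauss_smooth :: "real \<Rightarrow> 'a::euclidean_space measure \<Rightarrow> 'a \<Rightarrow> real" where
  "gauss_smooth t \<alpha> z = (\<integral>y. gauss t (z - y) \<partial>\<alpha>)"

lemma integrable_gauss:
  assumes "finite_measure \<nu>" "0 \<le> t" "\<psi> \<in> borel_measurable \<nu>"
  shows "integrable \<nu> (\<lambda>p. gauss t (\<psi> p :: 'a::euclidean_space))"
proof -
  interpret finite_measure \<nu> by fact
  note [measurable] = assms(3)
  show ?thesis by (rule integrable_const_bound[where B=1]) (auto simp: gauss_le_1[OF assms(2)])
qed

text \<open>Stated for a pair of measures because the signed measure of interest is not a
  \<open>measure\<close>: its quadratic form is assembled from three such pairings. All interchanges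
  are done for nonnegative integrals, so integrability comes out together with the value.\<close>

lemma gauss_smooth_mult:
  fixes \<alpha> \<beta> :: "'a::euclidean_space measure"
  assumes "finite_measure \<alpha>" "finite_measure \<beta>"
    and sets [measurable_cong]: "sets \<alpha> = sets borel" "sets \<beta> = sets borel" and t: "0 < t"
  shows "has_bochner_integral lborel (\<lambda>z. gauss_smooth (2 * t) \<alpha> z * gauss_smooth (2 * t) \<beta> z)
    ((pi / (4 * t)) powr (real DIM('a) / 2) * (\<integral>x. \<integral>y. gauss t (x - y) \<partial>\<beta> \<partial>\<alpha>))"
proof -
  interpret A: finite_measure \<alpha> by fact
  interpret B: finite_measure \<beta> by fact
  interpret AL: pair_sigma_finite \<alpha> lborel ..
  interpret BL: pair_sigma_finite \<beta> lborel ..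
  let ?c = "(pi / (4 * t)) powr (real DIM('a) / 2)"
  have A_eq: "ennreal (gauss_smooth (2 * t) \<alpha> z) = (\<integral>\<^sup>+x. ennreal (gauss (2 * t) (z - x)) \<partial>\<alpha>)" for z
    unfolding gauss_smooth_def by (rule nn_integral_eq_integral[symmetric])
      (use t assms in \<open>auto intro!: integrable_gauss\<close>)
  have B_eq: "ennreal (gauss_smooth (2 * t) \<beta> z) = (\<integral>\<^sup>+x. ennreal (gauss (2 * t) (z - x)) \<partial>\<beta>)" for z
    unfolding gauss_smooth_def by (rule nn_integral_eq_integral[symmetric])
      (use t assms in \<open>auto intro!: integrable_gauss\<close>)
  have inner_meas: "(\<lambda>x. \<integral>y. gauss t (x - y) \<partial>\<beta>) \<in> borel_measurable \<alpha>"
    by (rule B.borel_measurable_lebesgue_integral) measurable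
  have inner_int: "integrable \<beta> (\<lambda>y. gauss t (x - y))" for x
    using t assms by (auto intro!: integrable_gauss)
  have inner_bound: "(\<integral>y. gauss t (x - y) \<partial>\<beta>) \<le> measure \<beta> (space \<beta>)" for x
  proof -
    have "(\<integral>y. gauss t (x - y) \<partial>\<beta>) \<le> (\<integral>y. 1 \<partial>\<beta>)"
      by (rule integral_mono) (use inner_int gauss_le_1[of t] t in \<open>auto simp: less_imp_le\<close>)
    then show ?thesis by simp
  qed
  have outer_int: "integrable \<alpha> (\<lambda>x. \<integral>y. gauss t (x - y) \<partial>\<beta>)"
    by (rule A.integrable_const_bound[where B="measure \<beta> (space \<beta>)"])
      (use inner_bound inner_meas in auto)
  have "(\<integral>\<^sup>+z. ennreal (gauss_smooth (2 * t) \<alpha> z * gauss_smooth (2 * t) \<beta> z) \<partial>lborel)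
      = (\<integral>\<^sup>+z. (\<integral>\<^sup>+x. ennreal (gauss (2 * t) (z - x)) \<partial>\<alpha>) * (\<integral>\<^sup>+y. ennreal (gauss (2 * t) (z - y)) \<partial>\<beta>) \<partial>lborel)"
    unfolding A_eq[symmetric] B_eq[symmetric]
    by (subst ennreal_mult) (auto simp: gauss_smooth_def)
  also have "\<dots> = (\<integral>\<^sup>+z. \<integral>\<^sup>+x. (\<integral>\<^sup>+y. ennreal (gauss (2 * t) (z - x)) * ennreal (gauss (2 * t) (z - y)) \<partial>\<beta>) \<partial>\<alpha> \<partial>lborel)"
    by (simp add: nn_integral_cmult nn_integral_multc)
  also have "\<dots> = (\<integral>\<^sup>+x. \<integral>\<^sup>+z. (\<integral>\<^sup>+y. ennreal (gauss (2 * t) (z - x)) * ennreal (gauss (2 * t) (z - y)) \<partial>\<beta>) \<partial>lborel \<partial>\<alpha>)"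
    by (rule AL.Fubini') measurable
  also have "\<dots> = (\<integral>\<^sup>+x. \<integral>\<^sup>+y. (\<integral>\<^sup>+z. ennreal (gauss (2 * t) (z - x)) * ennreal (gauss (2 * t) (z - y)) \<partial>lborel) \<partial>\<beta> \<partial>\<alpha>)"
    by (intro nn_integral_cong BL.Fubini') measurable
  also have "\<dots> = (\<integral>\<^sup>+x. \<integral>\<^sup>+y. ennreal ?c * ennreal (gauss t (x - y)) \<partial>\<beta> \<partial>\<alpha>)"
    by (simp add: nn_integral_gauss_mult[OF t] flip: ennreal_mult)
  also have "\<dots> = ennreal ?c * (\<integral>\<^sup>+x. \<integral>\<^sup>+y. ennreal (gauss t (x - y)) \<partial>\<beta> \<partial>\<alpha>)"
    by (simp add: nn_integral_cmult)
  also have "(\<integral>\<^sup>+x. \<integral>\<^sup>+y. ennreal (gauss t (x - y)) \<partial>\<beta> \<partial>\<alpha>) = (\<integral>\<^sup>+x. ennreal (\<integral>y. gauss t (x - y) \<partial>\<beta>) \<partial>\<alpha>)"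
    by (intro nn_integral_cong nn_integral_eq_integral inner_int) auto
  also have "\<dots> = ennreal (\<integral>x. \<integral>y. gauss t (x - y) \<partial>\<beta> \<partial>\<alpha>)"
    by (rule nn_integral_eq_integral[OF outer_int]) auto
  finally have "(\<integral>\<^sup>+z. ennreal (gauss_smooth (2 * t) \<alpha> z * gauss_smooth (2 * t) \<beta> z) \<partial>lborel)
      = ennreal (?c * (\<integral>x. \<integral>y. gauss t (x - y) \<partial>\<beta> \<partial>\<alpha>))"
    by (simp add: ennreal_mult')
  moreover have "gauss_smooth (2 * t) \<alpha> \<in> borel_measurable borel" "gauss_smooth (2 * t) \<beta> \<in> borel_measurable borel"
    unfolding gauss_smooth_def
    by (rule A.borel_measurable_lebesgue_integral B.borel_measurable_lebesgue_integral; measurable)+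
  ultimately show ?thesis
    by (intro has_bochner_integral_nn_integral) (auto simp: gauss_smooth_def)
qed

text \<open>The quadratic form of the kernel \<open>f (x - y)\<close> on the signed measure
  \<open>(\<Sum>i\<in>{1..n}. \<delta> (X i)) - n \<cdot> \<mu>\<close>.\<close>

definition fluctuation_form ::
  "'a::euclidean_space measure \<Rightarrow> nat \<Rightarrow> (nat \<Rightarrow> 'a) \<Rightarrow> ('a \<Rightarrow> real) \<Rightarrow> real" where
  "fluctuation_form \<mu> n X f =
     (\<Sum>i\<in>{1..n}. \<Sum>j\<in>{1..n}. f (X i - X j)) - 2 * real n * (\<Sum>i\<in>{1..n}. \<integral>y. f (X i - y) \<partial>\<mu>)
     + (real n)\<^sup>2 * (\<integral>p. f (fst p - snd p) \<partial>(\<mu> \<Otimes>\<^sub>M \<mu>))"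

text \<open>Up to a positive constant the form is the integral of the square of the smoothed point
  masses minus \<open>n\<close> times the smoothed \<open>\<mu>\<close>.\<close>

lemma fluctuation_form_gauss_nonneg:
  fixes \<mu> :: "'a::euclidean_space measure"
  assumes "prob_space \<mu>" and sets [measurable_cong]: "sets \<mu> = sets borel" and t: "0 < t"
  shows "0 \<le> fluctuation_form \<mu> n X (gauss t)"
proof -
  interpret prob_space \<mu> by fact
  note measurable_integral = borel_measurable_lebesgue_integral
  interpret pair_prob_space \<mu> \<mu> ..
  have fin: "finite_measure \<mu>" by unfold_locales
  \<comment> \<open>The image of counting measure is the sum of the point masses at the
    \<open>X i\<close>, with multiplicity where points coincide.\<close>
  define \<alpha> where "\<alpha> = distr (count_space {1..n}) borel X"
  have int_\<alpha>: "(\<integral>x. f x \<partial>\<alpha>) = (\<Sum>i\<in>{1..n}. f (X i))" if "f \<in> borel_measurable borel" for f :: "'a \<Rightarrow> real"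
    unfolding \<alpha>_def using that by (subst integral_distr) (auto simp: lebesgue_integral_count_space_finite)
  have fin_\<alpha>: "finite_measure \<alpha>"
    unfolding \<alpha>_def by (intro finite_measure.finite_measure_distr finite_measure_count_space) auto
  have sets_\<alpha> [measurable_cong]: "sets \<alpha> = sets borel" by (simp add: \<alpha>_def)
  let ?c = "(pi / (4 * t)) powr (real DIM('a) / 2)"
  let ?A = "gauss_smooth (2 * t) \<alpha>" and ?M = "gauss_smooth (2 * t) \<mu>"
  have hbi: "has_bochner_integral lborel
      (\<lambda>z. ?A z * ?A z - 2 * real n * (?A z * ?M z) + (real n)\<^sup>2 * (?M z * ?M z))
      (?c * (\<integral>x. \<integral>y. gauss t (x - y) \<partial>\<alpha> \<partial>\<alpha>) - 2 * real n * (?c * (\<integral>x. \<integral>y. gauss t (x - y) \<partial>\<mu> \<partial>\<alpha>))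
        + (real n)\<^sup>2 * (?c * (\<integral>x. \<integral>y. gauss t (x - y) \<partial>\<mu> \<partial>\<mu>)))"
    by (intro has_bochner_integral_add has_bochner_integral_diff has_bochner_integral_mult_right
        gauss_smooth_mult fin fin_\<alpha> sets sets_\<alpha> t)
  have "?c * (\<integral>x. \<integral>y. gauss t (x - y) \<partial>\<alpha> \<partial>\<alpha>) - 2 * real n * (?c * (\<integral>x. \<integral>y. gauss t (x - y) \<partial>\<mu> \<partial>\<alpha>))
        + (real n)\<^sup>2 * (?c * (\<integral>x. \<integral>y. gauss t (x - y) \<partial>\<mu> \<partial>\<mu>))
      = (\<integral>z. (?A z - real n * ?M z)\<^sup>2 \<partial>lborel)"
    unfolding has_bochner_integral_integral_eq[OF hbi, symmetric]
    by (rule Bochner_Integration.integral_cong[OF refl]) (simp add: power2_eq_square algebra_simps)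
  then have "0 \<le> ?c * (\<integral>x. \<integral>y. gauss t (x - y) \<partial>\<alpha> \<partial>\<alpha>) - 2 * real n * (?c * (\<integral>x. \<integral>y. gauss t (x - y) \<partial>\<mu> \<partial>\<alpha>))
        + (real n)\<^sup>2 * (?c * (\<integral>x. \<integral>y. gauss t (x - y) \<partial>\<mu> \<partial>\<mu>))"
    by simp
  also have "\<dots> = ?c * ((\<integral>x. \<integral>y. gauss t (x - y) \<partial>\<alpha> \<partial>\<alpha>) - 2 * real n * (\<integral>x. \<integral>y. gauss t (x - y) \<partial>\<mu> \<partial>\<alpha>)
        + (real n)\<^sup>2 * (\<integral>x. \<integral>y. gauss t (x - y) \<partial>\<mu> \<partial>\<mu>))"
    by (simp add: algebra_simps)
  also have "(\<integral>x. \<integral>y. gauss t (x - y) \<partial>\<mu> \<partial>\<alpha>) = (\<Sum>i\<in>{1..n}. \<integral>y. gauss t (X i - y) \<partial>\<mu>)"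
    by (rule int_\<alpha>) (rule measurable_integral, measurable)
  also have "(\<integral>x. \<integral>y. gauss t (x - y) \<partial>\<alpha> \<partial>\<alpha>) = (\<Sum>i\<in>{1..n}. \<Sum>j\<in>{1..n}. gauss t (X i - X j))"
    by (subst int_\<alpha>, measurable, subst int_\<alpha>) (auto simp: gauss_def intro!: borel_measurable_sum)
  also have "(\<integral>x. \<integral>y. gauss t (x - y) \<partial>\<mu> \<partial>\<mu>) = (\<integral>p. gauss t (fst p - snd p) \<partial>(\<mu> \<Otimes>\<^sub>M \<mu>))"
  proof -
    have "integrable (\<mu> \<Otimes>\<^sub>M \<mu>) (\<lambda>p. gauss t (fst p - snd p))"
      using t by (intro integrable_gauss P.finite_measure_axioms) auto
    from integral_fst'[OF this] show ?thesis by simp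
  qed
  finally have "0 \<le> ?c * fluctuation_form \<mu> n X (gauss t)"
    by (simp add: fluctuation_form_def)
  moreover have "0 < ?c" using t by simp
  ultimately show ?thesis by (simp add: zero_le_mult_iff)
qed

section \<open>The Riesz kernel as a superposition of Gaussians\<close>

text \<open>The weight in \<open>g(x) - g(1) = \<integral> mix s t (e\<^bsup>-t|x|^2\<^esup> - e\<^bsup>-t\<^esup>) dt\<close> over \<open>t > 0\<close>. Subtracting \<open>e\<^bsup>-t\<^esup>\<close>
  makes the formula valid for \<open>s = 0\<close> as well; additive constants disappear in the centering.\<close>

definition mix :: "real \<Rightarrow> real \<Rightarrow> real" where
  "mix s t = t powr (s / 2 - 1) / (2 * Gamma (s / 2 + 1))"

lemma mix_nonneg: "0 \<le> s \<Longrightarrow> 0 \<le> mix s t"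
  by (simp add: mix_def Gamma_real_pos less_imp_le)

lemma measurable_mix [measurable]: "mix s \<in> borel_measurable borel"
  unfolding mix_def by measurable

text \<open>The kernel in the variable \<open>u = (norm x)\<^sup>2\<close>. Its derivative is
  \<open>- (u powr (- s / 2 - 1) / 2)\<close> for every \<open>s\<close>, including
  \<open>s = 0\<close>, so the logarithm and the powers share one proof below.\<close>

definition riesz_profile :: "real \<Rightarrow> real \<Rightarrow> real" where
  "riesz_profile s u = (if s = 0 then - ln u / 2 else u powr (- s / 2) / s)"

lemma riesz_kernel_eq_profile:
  "x \<noteq> 0 \<Longrightarrow> riesz_kernel s x = riesz_profile s ((norm x)\<^sup>2)"
  by (simp add: riesz_kernel_def riesz_profile_def ln_realpow powr_powr flip: powr_numeral)

lemma DERIV_riesz_profile: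
  "0 < u \<Longrightarrow> (riesz_profile s has_real_derivative - (u powr (- s / 2 - 1) / 2)) (at u)"
proof (cases "s = 0")
  case True
  assume u: "0 < u"
  have "((\<lambda>u. - ln u / 2) has_real_derivative - (u powr (- s / 2 - 1) / 2)) (at u)"
    using u True by (auto intro!: derivative_eq_intros simp: powr_minus_divide)
  then show ?thesis using True by (simp add: riesz_profile_def[abs_def])
next
  case False
  assume u: "0 < u"
  have "((\<lambda>u. u powr (- s / 2) / s) has_real_derivative - (u powr (- s / 2 - 1) / 2)) (at u)"
    using u False by (auto intro!: derivative_eq_intros simp: field_simps)
  then show ?thesis using False by (simp add: riesz_profile_def[abs_def])
qed

lemma nn_integral_Gamma_scaled:
  fixes p v :: real
  assumes "0 \<le> p" "0 < v"
  shows "(\<integral>\<^sup>+t. ennreal (indicator {0<..} t * (t powr p * exp (- t * v))) \<partial>lborel)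
    = ennreal (Gamma (p + 1) * v powr (- p - 1))"
proof -
  have "ennreal (Gamma (p + 1)) = (\<integral>\<^sup>+t. ennreal (indicator {0..} t * t powr p / exp t) \<partial>lborel)"
    using Gamma_conv_nn_integral_real[of "p + 1"] assms by simp
  also have "\<dots> = ennreal v * (\<integral>\<^sup>+t. ennreal (indicator {0..} (v * t) * (v * t) powr p / exp (v * t)) \<partial>lborel)"
    using nn_integral_real_affine[of "\<lambda>t. ennreal (indicator {0..} t * t powr p / exp t)" v 0] assms
    by simp
  also have "(\<integral>\<^sup>+t. ennreal (indicator {0..} (v * t) * (v * t) powr p / exp (v * t)) \<partial>lborel)
      = (\<integral>\<^sup>+t. ennreal (v powr p) * ennreal (indicator {0<..} t * (t powr p * exp (- t * v))) \<partial>lborel)"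
  proof (rule nn_integral_cong_AE)
    have "AE t in lborel. t \<noteq> (0::real)" by (rule AE_lborel_singleton)
    then show "AE t in lborel. ennreal (indicator {0..} (v * t) * (v * t) powr p / exp (v * t))
        = ennreal (v powr p) * ennreal (indicator {0<..} t * (t powr p * exp (- t * v)))"
    proof eventually_elim
      case (elim t)
      then show ?case using assms
        by (cases "0 < t")
          (auto simp: powr_mult exp_minus field_simps zero_le_mult_iff indicator_def simp flip: ennreal_mult)
    qed
  qed
  also have "\<dots> = ennreal (v powr p) * (\<integral>\<^sup>+t. ennreal (indicator {0<..} t * (t powr p * exp (- t * v))) \<partial>lborel)"
    by (rule nn_integral_cmult) measurable
  finally have eq: "ennreal (Gamma (p + 1)) = ennreal (v powr (p + 1))
      * (\<integral>\<^sup>+t. ennreal (indicator {0<..} t * (t powr p * exp (- t * v))) \<partial>lborel)"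
    using assms by (simp add: powr_add ennreal_mult mult.assoc mult.commute[of v])
      (simp add: ennreal_mult mult.assoc mult.left_commute)
  have "ennreal (v powr (- p - 1)) * ennreal (Gamma (p + 1))
     = ennreal (v powr (- p - 1) * v powr (p + 1))
      * (\<integral>\<^sup>+t. ennreal (indicator {0<..} t * (t powr p * exp (- t * v))) \<partial>lborel)"
    unfolding eq by (simp add: ennreal_mult mult.assoc)
  also have "v powr (- p - 1) * v powr (p + 1) = 1"
    using assms by (simp flip: powr_add)
  finally show ?thesis using Gamma_real_pos[of "p + 1"] assms
    by (simp add: ennreal_mult mult.commute)
qed

text \<open>Write the difference of exponentials as the integral of \<open>t * exp (- t * v)\<close>
  over \<open>v\<close> in \<open>{a..b}\<close> and exchange integrals: the inner one is a Gamma
  integral and yields minus the derivative of the profile. For \<open>s = 0\<close> this is a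
  Frullani integral, and only differences converge at \<open>t = 0\<close>.\<close>

lemma nn_integral_mix_diff:
  fixes a b :: real
  assumes s: "0 \<le> s" and ab: "0 < a" "a \<le> b"
  shows "(\<integral>\<^sup>+t. ennreal (indicator {0<..} t * (mix s t * (exp (- t * a) - exp (- t * b)))) \<partial>lborel)
    = ennreal (riesz_profile s a - riesz_profile s b)"
proof -
  have G: "0 < Gamma (s / 2 + 1)" using s by (simp add: Gamma_real_pos)
  have inner: "ennreal (indicator {0<..} t * (mix s t * (exp (- t * a) - exp (- t * b))))
      = (\<integral>\<^sup>+v. ennreal (indicator {0<..} t * (mix s t * (t * exp (- t * v)))) * indicator {a..b} v \<partial>lborel)" for t
  proof (cases "0 < t")
    case True
    have "(\<integral>\<^sup>+v. ennreal (mix s t * (t * exp (- t * v))) * indicator {a..b} v \<partial>lborel)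
        = ennreal (- mix s t * exp (- t * b) - - mix s t * exp (- t * a))"
    proof (rule nn_integral_FTC_Icc)
      fix x
      show "((\<lambda>v. - mix s t * exp (- t * v)) has_real_derivative mix s t * (t * exp (- t * x))) (at x)"
        by (auto intro!: derivative_eq_intros)
      show "0 \<le> mix s t * (t * exp (- t * x))" using True mix_nonneg[OF s] by simp
    qed (use ab in auto)
    then show ?thesis using True by (simp add: algebra_simps)
  qed simp
  have "(\<integral>\<^sup>+t. ennreal (indicator {0<..} t * (mix s t * (exp (- t * a) - exp (- t * b)))) \<partial>lborel)
    = (\<integral>\<^sup>+v. (\<integral>\<^sup>+t. ennreal (indicator {0<..} t * (mix s t * (t * exp (- t * v)))) * indicator {a..b} v \<partial>lborel) \<partial>lborel)"
    unfolding inner by (rule lborel_pair.Fubini'[symmetric]) measurable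
  also have "\<dots> = (\<integral>\<^sup>+v. ennreal (v powr (- s / 2 - 1) / 2) * indicator {a..b} v \<partial>lborel)"
  proof (rule nn_integral_cong)
    fix v :: real
    have "(\<integral>\<^sup>+t. ennreal (indicator {0<..} t * (mix s t * (t * exp (- t * v)))) \<partial>lborel) = ennreal (v powr (- s / 2 - 1) / 2)"
      if v: "0 < v"
    proof -
      have "(\<integral>\<^sup>+t. ennreal (indicator {0<..} t * (mix s t * (t * exp (- t * v)))) \<partial>lborel)
          = (\<integral>\<^sup>+t. ennreal (1 / (2 * Gamma (s / 2 + 1))) * ennreal (indicator {0<..} t * (t powr (s / 2) * exp (- t * v))) \<partial>lborel)"
      proof (rule nn_integral_cong)
        fix t :: real
        have "mix s t * t = t powr (s / 2) / (2 * Gamma (s / 2 + 1))" if "0 < t"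
          using that powr_add[of t "s / 2 - 1" 1] by (simp add: mix_def)
        then show "ennreal (indicator {0<..} t * (mix s t * (t * exp (- t * v))))
          = ennreal (1 / (2 * Gamma (s / 2 + 1))) * ennreal (indicator {0<..} t * (t powr (s / 2) * exp (- t * v)))"
          using G by (cases "0 < t") (auto simp flip: ennreal_mult mult.assoc)
      qed
      also have "\<dots> = ennreal (1 / (2 * Gamma (s / 2 + 1))) * ennreal (Gamma (s / 2 + 1) * v powr (- (s / 2) - 1))"
        using s v by (subst nn_integral_cmult) (measurable, simp only: nn_integral_Gamma_scaled[of "s / 2" v])
      finally show ?thesis using G by (simp flip: ennreal_mult)
    qed
    then show "(\<integral>\<^sup>+t. ennreal (indicator {0<..} t * (mix s t * (t * exp (- t * v)))) * indicator {a..b} v \<partial>lborel)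
        = ennreal (v powr (- s / 2 - 1) / 2) * indicator {a..b} v"
      using ab by (cases "v \<in> {a..b}") (auto simp del: times_divide_eq_right)
  qed
  also have "\<dots> = ennreal (- riesz_profile s b - - riesz_profile s a)"
  proof (rule nn_integral_FTC_Icc)
    fix x assume "x \<in> {a..b}"
    then show "((\<lambda>x. - riesz_profile s x) has_real_derivative x powr (- s / 2 - 1) / 2) (at x)"
      using DERIV_minus[OF DERIV_riesz_profile[of x s]] ab by simp
  qed (use ab in auto)
  finally show ?thesis by simp
qed

lemma has_bochner_integral_mix_diff:
  fixes u :: real
  assumes s: "0 \<le> s" and u: "0 < u"
  shows "has_bochner_integral lborel
    (\<lambda>t. indicator {0<..} t * (mix s t * (exp (- t * u) - exp (- t)))) (riesz_profile s u - riesz_profile s 1)"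
proof -
  have *: "has_bochner_integral lborel
      (\<lambda>t. indicator {0<..} t * (mix s t * (exp (- t * a) - exp (- t * b)))) (riesz_profile s a - riesz_profile s b)"
    if ab: "0 < a" "a \<le> b" for a b
  proof (rule has_bochner_integral_nn_integral)
    show "AE t in lborel. 0 \<le> indicator {0<..} t * (mix s t * (exp (- t * a) - exp (- t * b)))"
      using ab mix_nonneg[OF s] by (auto simp: indicator_def)
    show "0 \<le> riesz_profile s a - riesz_profile s b"
      using DERIV_nonpos_imp_nonincreasing[OF ab(2), of "riesz_profile s"] DERIV_riesz_profile ab(1)
      by (metis diff_ge_0_iff_ge divide_nonneg_nonneg le_minus_iff minus_zero neg_le_0_iff_le order_less_le_trans powr_ge_zero zero_le_numeral)
  qed (use nn_integral_mix_diff[OF s ab] in auto)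
  show ?thesis
  proof (cases "u \<le> 1")
    case True then show ?thesis using *[of u 1] u by simp
  next
    case False
    then have "has_bochner_integral lborel
      (\<lambda>t. - (indicator {0<..} t * (mix s t * (exp (- t * 1) - exp (- t * u))))) (- (riesz_profile s 1 - riesz_profile s u))"
      by (intro has_bochner_integral_minus *) auto
    then show ?thesis by (simp add: algebra_simps)
  qed
qed

section \<open>The cutoff at frequency \<open>T\<close>\<close>

definition riesz_high :: "real \<Rightarrow> real \<Rightarrow> 'a::euclidean_space \<Rightarrow> real" where
  "riesz_high s T x = (\<integral>t. indicator {T..} t * (mix s t * gauss t x) \<partial>lborel)"

text \<open>The subtraction of \<open>exp (- t)\<close> is confined to low frequencies, where
  convergence at \<open>t = 0\<close> may require it. Left out of \<open>riesz_high\<close>, it does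
  not spoil the sign there.\<close>

definition riesz_low :: "real \<Rightarrow> real \<Rightarrow> 'a::euclidean_space \<Rightarrow> real" where
  "riesz_low s T x = (\<integral>t. indicator {0<..<T} t * (mix s t * (gauss t x - exp (- t))) \<partial>lborel)"

lemma measurable_riesz_high [measurable]: "riesz_high s T \<in> borel_measurable borel"
  and measurable_riesz_low [measurable]: "riesz_low s T \<in> borel_measurable borel"
  unfolding riesz_high_def riesz_low_def gauss_def
  by (rule lborel.borel_measurable_lebesgue_integral, measurable)+

lemma riesz_high_minus_commute: "riesz_high s T (x - y) = riesz_high s T (y - x)"
  by (simp add: riesz_high_def gauss_minus_commute)

lemma riesz_high_nonneg: "0 \<le> s \<Longrightarrow> 0 \<le> riesz_high s T x"
  unfolding riesz_high_def by (intro Bochner_Integration.integral_nonneg mult_nonneg_nonneg mix_nonneg) auto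

text \<open>Only an inequality: at \<open>x = 0\<close> the right-hand side is infinite, while the Bochner integral
  \<open>riesz_high\<close> takes the value 0 there.\<close>

lemma ennreal_riesz_high_le:
  assumes "0 \<le> s"
  shows "ennreal (riesz_high s T x) \<le> (\<integral>\<^sup>+t. ennreal (mix s t * gauss t x) * indicator {T..} t \<partial>lborel)"
proof -
  have "ennreal (riesz_high s T x) \<le> (\<integral>\<^sup>+t. ennreal (indicator {T..} t * (mix s t * gauss t x)) \<partial>lborel)"
  proof (cases "integrable lborel (\<lambda>t. indicator {T..} t * (mix s t * gauss t x))")
    case True
    then show ?thesis unfolding riesz_high_def
      by (subst nn_integral_eq_integral) (auto simp: mix_nonneg[OF assms])
  qed (simp add: riesz_high_def not_integrable_integral_eq)
  also have "\<dots> = (\<integral>\<^sup>+t. ennreal (mix s t * gauss t x) * indicator {T..} t \<partial>lborel)"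
    by (rule nn_integral_cong) (auto split: split_indicator)
  finally show ?thesis .
qed

text \<open>On \<open>{T..}\<close> one power of \<open>t\<close> can be traded for
  \<open>1 / T\<close>. The majorant is then a Gamma integrand with exponent \<open>s / 2\<close>,
  integrable at 0 even for \<open>s = 0\<close>, where \<open>mix s\<close> itself is not.\<close>

lemma integrable_mix_exp:
  assumes s: "0 \<le> s" and T: "0 < T" and u: "0 < u"
  shows "integrable lborel (\<lambda>t. indicator {T..} t * (mix s t * exp (- t * u)))"
proof (rule Bochner_Integration.integrable_bound)
  have G: "0 < Gamma (s / 2 + 1)" using s by (simp add: Gamma_real_pos)
  have "integrable lborel (\<lambda>t. indicator {0<..} t * (t powr (s / 2) * exp (- t * u)))"
    by (rule integrableI_nn_integral_finite[where x="Gamma (s / 2 + 1) * u powr (- (s / 2) - 1)"])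
      (use nn_integral_Gamma_scaled[of "s / 2" u] s u G in auto)
  then show "integrable lborel (\<lambda>t. 1 / (2 * Gamma (s / 2 + 1) * T) * (indicator {0<..} t * (t powr (s / 2) * exp (- t * u))))"
    by simp
  show "AE t in lborel. norm (indicator {T..} t * (mix s t * exp (- t * u)))
    \<le> norm (1 / (2 * Gamma (s / 2 + 1) * T) * (indicator {0<..} t * (t powr (s / 2) * exp (- t * u))))"
  proof (rule AE_I2)
    fix t :: real
    have "mix s t \<le> t powr (s / 2) / (2 * Gamma (s / 2 + 1) * T)" if "T \<le> t"
    proof -
      have "t powr (s / 2) = t * t powr (s / 2 - 1)"
        using that T powr_add[of t "s / 2 - 1" 1] by simp
      also have "\<dots> \<ge> T * t powr (s / 2 - 1)" using that by (intro mult_right_mono) auto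
      finally show ?thesis using G T by (simp add: mix_def field_simps)
    qed
    then have "mix s t * exp (- t * u) \<le> t powr (s / 2) / (2 * Gamma (s / 2 + 1) * T) * exp (- t * u)" if "T \<le> t"
      using that by (intro mult_right_mono) auto
    then show "norm (indicator {T..} t * (mix s t * exp (- t * u)))
      \<le> norm (1 / (2 * Gamma (s / 2 + 1) * T) * (indicator {0<..} t * (t powr (s / 2) * exp (- t * u))))"
      using T G mix_nonneg[OF s, of t] by (auto simp: indicator_def abs_mult)
  qed
qed measurable

text \<open>The balance of constants in \<open>riesz_kernel_split\<close>. It drops out of the
  centered kernel, but half of it survives in the modulated energy through the single-particle
  terms.\<close>

definition riesz_shift :: "real \<Rightarrow> real \<Rightarrow> real" where
  "riesz_shift s T = riesz_profile s 1 - (\<integral>t. indicator {T..} t * (mix s t * exp (- t)) \<partial>lborel)"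

text \<open>For \<open>x \<noteq> 0\<close> this is a piece of the full superposition. At
  \<open>x = 0\<close>, the value that enters the diagonal, the full integral diverges at infinity;
  the cutoff removes this, and \<open>1 - exp (- t) \<le> t\<close> tames \<open>mix s\<close> near
  0.\<close>

lemma integrable_riesz_low:
  assumes s: "0 \<le> s" and T: "0 < T"
  shows "integrable lborel (\<lambda>t. indicator {0<..<T} t * (mix s t * (gauss t x - exp (- t))))"
proof (cases "x = 0")
  case False
  then have "integrable lborel (\<lambda>t. indicator {0<..} t * (mix s t * (exp (- t * (norm x)\<^sup>2) - exp (- t))))"
    using has_bochner_integral_mix_diff[OF s, of "(norm x)\<^sup>2"] by (auto simp: has_bochner_integral_iff)
  from integrable_mult_indicator[OF _ this, of "{..<T}"]
  show ?thesis by (simp add: gauss_def) (rule Bochner_Integration.integrable_cong[THEN iffD1, rotated 2], assumption,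
        auto simp: indicator_def)
next
  case True
  have G: "0 < Gamma (s / 2 + 1)" using s by (simp add: Gamma_real_pos)
  show ?thesis
  proof (rule Bochner_Integration.integrable_bound)
    show "integrable lborel (\<lambda>t. T powr (s / 2) / (2 * Gamma (s / 2 + 1)) * indicator {0..T} t)"
      by (intro integrable_mult_right integrable_real_indicator) (auto simp: emeasure_lborel_Icc_eq)
    show "AE t in lborel. norm (indicator {0<..<T} t * (mix s t * (gauss t x - exp (- t))))
      \<le> norm (T powr (s / 2) / (2 * Gamma (s / 2 + 1)) * indicator {0..T} t)"
    proof (rule AE_I2)
      fix t :: real
      have "mix s t * (1 - exp (- t)) \<le> T powr (s / 2) / (2 * Gamma (s / 2 + 1))" if t: "0 < t" "t < T"
      proof -
        have "mix s t * (1 - exp (- t)) \<le> mix s t * t"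
          using exp_ge_add_one_self[of "- t"] mix_nonneg[OF s] by (intro mult_left_mono) auto
        also have "\<dots> = t powr (s / 2) / (2 * Gamma (s / 2 + 1))"
          using t powr_add[of t "s / 2 - 1" 1] by (simp add: mix_def)
        also have "\<dots> \<le> T powr (s / 2) / (2 * Gamma (s / 2 + 1))"
          using t G s by (intro divide_right_mono powr_mono2) auto
        finally show ?thesis .
      qed
      then show "norm (indicator {0<..<T} t * (mix s t * (gauss t x - exp (- t))))
      \<le> norm (T powr (s / 2) / (2 * Gamma (s / 2 + 1)) * indicator {0..T} t)"
        using mix_nonneg[OF s, of t] G by (auto simp: indicator_def True gauss_def abs_mult)
    qed
  qed (unfold gauss_def, measurable)
qed

lemma riesz_kernel_split:
  assumes s: "0 \<le> s" and T: "0 < T" and x: "x \<noteq> 0"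
  shows "riesz_kernel s x = riesz_shift s T + riesz_low s T x + riesz_high s T x"
proof -
  have u: "0 < (norm x)\<^sup>2" using x by simp
  note int_high = integrable_mix_exp[OF s T u] integrable_mix_exp[OF s T zero_less_one]
  have "riesz_profile s ((norm x)\<^sup>2) - riesz_profile s 1
      = (\<integral>t. indicator {0<..} t * (mix s t * (exp (- t * (norm x)\<^sup>2) - exp (- t))) \<partial>lborel)"
    using has_bochner_integral_mix_diff[OF s u] by (simp add: has_bochner_integral_iff)
  also have "\<dots> = (\<integral>t. indicator {0<..<T} t * (mix s t * (gauss t x - exp (- t)))
      + (indicator {T..} t * (mix s t * gauss t x) - indicator {T..} t * (mix s t * exp (- t))) \<partial>lborel)"
    using T by (intro Bochner_Integration.integral_cong) (auto simp: indicator_def gauss_def algebra_simps)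
  also have "\<dots> = riesz_low s T x + (riesz_high s T x - (\<integral>t. indicator {T..} t * (mix s t * exp (- t)) \<partial>lborel))"
    unfolding riesz_low_def riesz_high_def
    using int_high integrable_riesz_low[OF s T, of x] by (simp add: gauss_def)
  finally show ?thesis using x by (simp add: riesz_kernel_eq_profile riesz_shift_def)
qed

section \<open>Norms of the high-frequency part, and the low-frequency value at the origin\<close>

lemma nn_integral_powr_tail:
  fixes a T :: real
  assumes a: "0 < a" and T: "0 < T"
  shows "(\<integral>\<^sup>+t. ennreal (t powr (- a - 1)) * indicator {T..} t \<partial>lborel) = ennreal (T powr (- a) / a)"
proof -
  have "(\<integral>\<^sup>+t. ennreal (t powr (- a - 1)) * indicator {T..} t \<partial>lborel) = ennreal (0 - - (T powr (- a) / a))"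
  proof (rule nn_integral_FTC_atLeast)
    fix t assume "T \<le> t"
    then show "((\<lambda>t. - (t powr (- a) / a)) has_real_derivative t powr (- a - 1)) (at t)"
      using a T by (auto intro!: derivative_eq_intros simp: field_simps)
  next
    have "((\<lambda>t. t powr (- a)) \<longlongrightarrow> 0) at_top"
      using a by (intro tendsto_neg_powr filterlim_ident) auto
    then show "((\<lambda>t. - (t powr (- a) / a)) \<longlongrightarrow> 0) at_top"
      using tendsto_minus[OF tendsto_divide[OF _ tendsto_const[of a]]] a by fastforce
  qed auto
  then show ?thesis by simp
qed

text \<open>A Gaussian of parameter \<open>t\<close> has mass \<open>(pi / t) powr (d / 2)\<close>,
  so after exchanging integrals a power tail with exponent \<open>(s - d) / 2 - 1\<close> remains;
  it converges because \<open>s < d\<close>.\<close>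

lemma nn_integral_riesz_high_le:
  assumes s: "0 \<le> s" "s < real DIM('a)" and T: "0 < T"
  shows "(\<integral>\<^sup>+x. ennreal (riesz_high s T (x::'a::euclidean_space)) \<partial>lborel)
    \<le> ennreal (pi powr (real DIM('a) / 2) / (Gamma (s / 2 + 1) * (real DIM('a) - s)) * T powr ((s - real DIM('a)) / 2))"
proof -
  let ?d = "real DIM('a)"
  have G: "0 < Gamma (s / 2 + 1)" using s by (simp add: Gamma_real_pos)
  have "(\<integral>\<^sup>+x. ennreal (riesz_high s T (x::'a)) \<partial>lborel)
      \<le> (\<integral>\<^sup>+x. (\<integral>\<^sup>+t. ennreal (mix s t * gauss t (x::'a)) * indicator {T..} t \<partial>lborel) \<partial>lborel)"
    by (intro nn_integral_mono ennreal_riesz_high_le s)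
  also have "\<dots> = (\<integral>\<^sup>+t. (\<integral>\<^sup>+x. ennreal (mix s t * gauss t (x::'a)) * indicator {T..} t \<partial>lborel) \<partial>lborel)"
    by (rule lborel_pair.Fubini'[symmetric]) (unfold gauss_def, measurable)
  also have "\<dots> = (\<integral>\<^sup>+t. ennreal (pi powr (?d / 2) / (2 * Gamma (s / 2 + 1)))
      * (ennreal (t powr (- ((?d - s) / 2) - 1)) * indicator {T..} t) \<partial>lborel)"
  proof (rule nn_integral_cong)
    fix t :: real
    show "(\<integral>\<^sup>+x. ennreal (mix s t * gauss t (x::'a)) * indicator {T..} t \<partial>lborel)
      = ennreal (pi powr (?d / 2) / (2 * Gamma (s / 2 + 1))) * (ennreal (t powr (- ((?d - s) / 2) - 1)) * indicator {T..} t)"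
    proof (cases "T \<le> t")
      case True
      then have t: "0 < t" using T by simp
      have "(\<integral>\<^sup>+x. ennreal (mix s t * gauss t (x::'a)) \<partial>lborel) = ennreal (mix s t) * ennreal ((pi / t) powr (?d / 2))"
        using mix_nonneg[OF s(1)] by (simp add: ennreal_mult nn_integral_cmult nn_integral_gauss[OF t])
      also have "mix s t * (pi / t) powr (?d / 2)
          = pi powr (?d / 2) / (2 * Gamma (s / 2 + 1)) * t powr (- ((?d - s) / 2) - 1)"
      proof -
        have "t powr (s / 2 - 1) / t powr (?d / 2) = t powr (- ((?d - s) / 2) - 1)"
          unfolding powr_diff[symmetric] by (rule arg_cong[where f="(powr) t"]) (simp add: field_simps)
        then show ?thesis using t by (simp add: mix_def powr_divide) (simp add: field_simps)
      qed
      then have "ennreal (mix s t) * ennreal ((pi / t) powr (?d / 2))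
        = ennreal (pi powr (?d / 2) / (2 * Gamma (s / 2 + 1))) * ennreal (t powr (- ((?d - s) / 2) - 1))"
        using mix_nonneg[OF s(1), of t] G by (simp flip: ennreal_mult)
      finally show ?thesis using True by simp
    qed simp
  qed
  also have "\<dots> = ennreal (pi powr (?d / 2) / (2 * Gamma (s / 2 + 1))) * ennreal (T powr (- ((?d - s) / 2)) / ((?d - s) / 2))"
    using nn_integral_powr_tail[of "(?d - s) / 2" T] s T by (subst nn_integral_cmult) auto
  also have "\<dots> = ennreal (pi powr (?d / 2) / (Gamma (s / 2 + 1) * (?d - s)) * T powr ((s - ?d) / 2))"
  proof -
    have "2 * Gamma (s / 2 + 1) * ((?d - s) / 2) = Gamma (s / 2 + 1) * (?d - s)" by simp
    moreover have e: "- ((?d - s) / 2) = (s - ?d) / 2" by (simp add: field_simps)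
    ultimately show ?thesis unfolding e using G s by (simp flip: ennreal_mult)
  qed
  finally show ?thesis .
qed

text \<open>Squaring produces a double integral over frequencies of the mass of
  \<open>gauss (t + r)\<close>. A product bound for that mass turns the double integral into a
  square of a tail with exponent \<open>s / 2 - d / 4 - 1\<close>; its convergence is the condition
  \<open>s < d / 2\<close>.\<close>

lemma nn_integral_riesz_high_sq_le:
  assumes s: "0 \<le> s" "s < real DIM('a) / 2" and T: "0 < T"
  shows "(\<integral>\<^sup>+x. ennreal ((riesz_high s T (x::'a::euclidean_space))\<^sup>2) \<partial>lborel)
    \<le> ennreal ((pi powr (real DIM('a) / 4) / (Gamma (s / 2 + 1) * (real DIM('a) / 2 - s)) * T powr (s / 2 - real DIM('a) / 4))\<^sup>2)"
proof -
  let ?d = "real DIM('a)"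
  have G: "0 < Gamma (s / 2 + 1)" using s by (simp add: Gamma_real_pos)
  define W where "W t = (ennreal (mix s t) * indicator {T..} t :: ennreal)" for t
  have [measurable]: "W \<in> borel_measurable borel" unfolding W_def by measurable
  have [measurable]: "(\<lambda>p. gauss (fst p) (snd p :: 'a)) \<in> borel_measurable (lborel \<Otimes>\<^sub>M lborel)"
    unfolding gauss_def by measurable
  have le: "ennreal (riesz_high s T x) \<le> (\<integral>\<^sup>+t. W t * ennreal (gauss t x) \<partial>lborel)" for x :: 'a
    using ennreal_riesz_high_le[OF s(1), of T x] mix_nonneg[OF s(1)]
    by (simp add: W_def ennreal_mult ac_simps)
  have "(\<integral>\<^sup>+x. ennreal ((riesz_high s T (x::'a))\<^sup>2) \<partial>lborel)
      \<le> (\<integral>\<^sup>+x. (\<integral>\<^sup>+t. W t * ennreal (gauss t (x::'a)) \<partial>lborel) * (\<integral>\<^sup>+r. W r * ennreal (gauss r x) \<partial>lborel) \<partial>lborel)"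
    by (intro nn_integral_mono)
      (simp add: power2_eq_square ennreal_mult riesz_high_nonneg[OF s(1)] mult_mono le)
  also have "\<dots> = (\<integral>\<^sup>+x. (\<integral>\<^sup>+t. (\<integral>\<^sup>+r. W t * W r * ennreal (gauss (t + r) (x::'a)) \<partial>lborel) \<partial>lborel) \<partial>lborel)"
  proof (rule nn_integral_cong)
    fix x :: 'a
    have [measurable]: "(\<lambda>t. gauss t x) \<in> borel_measurable borel" unfolding gauss_def by measurable
    have "(\<integral>\<^sup>+t. W t * ennreal (gauss t x) \<partial>lborel) * (\<integral>\<^sup>+r. W r * ennreal (gauss r x) \<partial>lborel)
      = (\<integral>\<^sup>+t. (\<integral>\<^sup>+r. (W t * ennreal (gauss t x)) * (W r * ennreal (gauss r x)) \<partial>lborel) \<partial>lborel)"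
      by (simp add: nn_integral_cmult nn_integral_multc)
    also have "(\<lambda>t r. (W t * ennreal (gauss t x)) * (W r * ennreal (gauss r x))) = (\<lambda>t r. W t * W r * ennreal (gauss (t + r) x))"
    proof (intro ext)
      fix t r
      have "gauss (t + r) x = gauss t x * gauss r x"
        by (simp add: gauss_def algebra_simps flip: exp_add)
      then show "(W t * ennreal (gauss t x)) * (W r * ennreal (gauss r x)) = W t * W r * ennreal (gauss (t + r) x)"
        by (simp add: ennreal_mult ac_simps)
    qed
    finally show "(\<integral>\<^sup>+t. W t * ennreal (gauss t x) \<partial>lborel) * (\<integral>\<^sup>+r. W r * ennreal (gauss r x) \<partial>lborel)
      = (\<integral>\<^sup>+t. (\<integral>\<^sup>+r. W t * W r * ennreal (gauss (t + r) x) \<partial>lborel) \<partial>lborel)" .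
  qed
  also have "\<dots> = (\<integral>\<^sup>+t. (\<integral>\<^sup>+x. (\<integral>\<^sup>+r. W t * W r * ennreal (gauss (t + r) (x::'a)) \<partial>lborel) \<partial>lborel) \<partial>lborel)"
    by (rule lborel_pair.Fubini'[symmetric]) (unfold gauss_def, measurable)
  also have "\<dots> = (\<integral>\<^sup>+t. (\<integral>\<^sup>+r. (\<integral>\<^sup>+x. W t * W r * ennreal (gauss (t + r) (x::'a)) \<partial>lborel) \<partial>lborel) \<partial>lborel)"
    by (intro nn_integral_cong lborel_pair.Fubini'[symmetric]) (unfold gauss_def, measurable)
  also have "\<dots> \<le> (\<integral>\<^sup>+t. (\<integral>\<^sup>+r. (W t * ennreal (pi powr (?d / 4) * t powr (- ?d / 4))) * (W r * ennreal (pi powr (?d / 4) * r powr (- ?d / 4))) \<partial>lborel) \<partial>lborel)"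
  proof (intro nn_integral_mono)
    fix t r :: real
    show "(\<integral>\<^sup>+x. W t * W r * ennreal (gauss (t + r) (x::'a)) \<partial>lborel)
        \<le> (W t * ennreal (pi powr (?d / 4) * t powr (- ?d / 4))) * (W r * ennreal (pi powr (?d / 4) * r powr (- ?d / 4)))"
    proof (cases "T \<le> t \<and> T \<le> r")
      case True
      then have tr: "0 < t" "0 < r" using T by auto
      \<comment> \<open>\<open>sqrt (t r) \<le> t + r\<close> separates the variables.\<close>
      have "(pi / (t + r)) powr (?d / 2) \<le> (pi / sqrt (t * r)) powr (?d / 2)"
      proof (rule powr_mono2)
        have "t * r \<le> (t + r)\<^sup>2" using tr by (simp add: power2_eq_square algebra_simps)
        then have "sqrt (t * r) \<le> t + r" using tr by (intro real_le_lsqrt) auto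
        then show "pi / (t + r) \<le> pi / sqrt (t * r)" using tr by (intro divide_left_mono) auto
      qed (use tr in auto)
      also have "\<dots> = (pi powr (?d / 4) * t powr (- ?d / 4)) * (pi powr (?d / 4) * r powr (- ?d / 4))"
        using tr by (simp add: powr_divide powr_half_sqrt[symmetric] powr_powr powr_mult powr_minus field_simps flip: powr_add)
      finally have le: "(pi / (t + r)) powr (?d / 2) \<le> (pi powr (?d / 4) * t powr (- ?d / 4)) * (pi powr (?d / 4) * r powr (- ?d / 4))" .
      have "(\<integral>\<^sup>+x. W t * W r * ennreal (gauss (t + r) (x::'a)) \<partial>lborel) = W t * W r * ennreal ((pi / (t + r)) powr (?d / 2))"
        using tr by (simp add: nn_integral_cmult nn_integral_gauss)
      also have "\<dots> \<le> W t * W r * ennreal ((pi powr (?d / 4) * t powr (- ?d / 4)) * (pi powr (?d / 4) * r powr (- ?d / 4)))"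
        by (intro mult_left_mono ennreal_leI le) auto
      also have "\<dots> = (W t * ennreal (pi powr (?d / 4) * t powr (- ?d / 4))) * (W r * ennreal (pi powr (?d / 4) * r powr (- ?d / 4)))"
        by (subst ennreal_mult) (auto simp: ac_simps)
      finally show ?thesis .
    qed (auto simp: W_def)
  qed
  also have "\<dots> = (\<integral>\<^sup>+t. W t * ennreal (pi powr (?d / 4) * t powr (- ?d / 4)) \<partial>lborel)\<^sup>2"
    by (simp add: nn_integral_cmult nn_integral_multc power2_eq_square)
  also have "(\<integral>\<^sup>+t. W t * ennreal (pi powr (?d / 4) * t powr (- ?d / 4)) \<partial>lborel)
      = (\<integral>\<^sup>+t. ennreal (pi powr (?d / 4) / (2 * Gamma (s / 2 + 1))) * (ennreal (t powr (- (?d / 4 - s / 2) - 1)) * indicator {T..} t) \<partial>lborel)"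
  proof (rule nn_integral_cong)
    fix t :: real
    have "mix s t * (pi powr (?d / 4) * t powr (- ?d / 4))
        = pi powr (?d / 4) / (2 * Gamma (s / 2 + 1)) * t powr (- (?d / 4 - s / 2) - 1)"
    proof -
      have "t powr (s / 2 - 1) * t powr (- ?d / 4) = t powr (- (?d / 4 - s / 2) - 1)"
        by (simp add: algebra_simps flip: powr_add)
      then show ?thesis by (simp add: mix_def field_simps)
    qed
    then have "ennreal (mix s t) * ennreal (pi powr (?d / 4) * t powr (- ?d / 4))
        = ennreal (pi powr (?d / 4) / (2 * Gamma (s / 2 + 1))) * ennreal (t powr (- (?d / 4 - s / 2) - 1))"
      using mix_nonneg[OF s(1), of t] G by (simp flip: ennreal_mult)
    then show "W t * ennreal (pi powr (?d / 4) * t powr (- ?d / 4))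
      = ennreal (pi powr (?d / 4) / (2 * Gamma (s / 2 + 1))) * (ennreal (t powr (- (?d / 4 - s / 2) - 1)) * indicator {T..} t)"
      by (cases "T \<le> t") (auto simp: W_def)
  qed
  also have "\<dots> = ennreal (pi powr (?d / 4) / (2 * Gamma (s / 2 + 1))) * ennreal (T powr (- (?d / 4 - s / 2)) / (?d / 4 - s / 2))"
    using nn_integral_powr_tail[of "?d / 4 - s / 2" T] s T by (subst nn_integral_cmult) auto
  also have "\<dots> = ennreal (pi powr (?d / 4) / (Gamma (s / 2 + 1) * (?d / 2 - s)) * T powr (s / 2 - ?d / 4))"
  proof -
    have "2 * Gamma (s / 2 + 1) * (?d / 4 - s / 2) = Gamma (s / 2 + 1) * (?d / 2 - s)" by (simp add: algebra_simps)
    then show ?thesis using G s by (simp flip: ennreal_mult)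
  qed
  also have "\<dots>\<^sup>2 = ennreal ((pi powr (?d / 4) / (Gamma (s / 2 + 1) * (?d / 2 - s)) * T powr (s / 2 - ?d / 4))\<^sup>2)"
    using G s by (intro ennreal_power) auto
  finally show ?thesis .
qed

text \<open>Split at \<open>t = 1\<close>: below, \<open>1 - exp (- t) \<le> t\<close> bounds the
  integrand; above, the factor \<open>1 - exp (- t)\<close> is dropped. The dichotomy between
  \<open>ln T\<close> and a power of \<open>T\<close> is the origin of the two forms of
  \<open>energy_rate\<close>.\<close>

lemma riesz_low_0_le:
  assumes s: "0 \<le> s" and T: "1 \<le> T"
  shows "riesz_low s T (0::'a::euclidean_space) \<le> 1 / (2 * Gamma (s / 2 + 1))
    * (1 + (if s = 0 then ln T else 2 / s * T powr (s / 2)))"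
proof -
  have G: "0 < Gamma (s / 2 + 1)" using s by (simp add: Gamma_real_pos)
  define F where "F t = (if s = 0 then ln t else 2 / s * t powr (s / 2))" for t :: real
  have "has_bochner_integral lborel (\<lambda>t. t powr (s / 2 - 1) * indicator {1..T} t) (F T - F 1)"
  proof (rule has_bochner_integral_FTC_Icc_nonneg)
    fix t assume "t \<in> {1..T}"
    then have t: "0 < t" by simp
    show "(F has_real_derivative t powr (s / 2 - 1)) (at t)"
    proof (cases "s = 0")
      case True
      then have "F = ln" by (auto simp: F_def)
      then show ?thesis using t True by (auto intro!: derivative_eq_intros simp: powr_minus_divide)
    next
      case False
      then have "F = (\<lambda>t. 2 / s * t powr (s / 2))" by (auto simp: F_def)
      then show ?thesis using t False by (auto intro!: derivative_eq_intros)
    qed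
  qed (use T in auto)
  then have int: "integrable lborel (\<lambda>t. t powr (s / 2 - 1) * indicator {1..T} t)"
    and eq: "(\<integral>t. t powr (s / 2 - 1) * indicator {1..T} t \<partial>lborel) = F T - F 1"
    by (auto simp: has_bochner_integral_iff)
  have int01: "integrable lborel (indicator {0..1::real} :: real \<Rightarrow> real)"
    by (intro integrable_real_indicator) (auto simp: emeasure_lborel_Icc_eq)
  have "riesz_low s T (0::'a) \<le> (\<integral>t. 1 / (2 * Gamma (s / 2 + 1)) * (indicator {0..1} t + t powr (s / 2 - 1) * indicator {1..T} t) \<partial>lborel)"
    unfolding riesz_low_def
  proof (rule integral_mono)
    show "integrable lborel (\<lambda>t. indicator {0<..<T} t * (mix s t * (gauss t (0::'a) - exp (- t))))"
      using integrable_riesz_low[OF s, of T "0::'a"] T by simp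
    show "integrable lborel (\<lambda>t. 1 / (2 * Gamma (s / 2 + 1)) * (indicator {0..1} t + t powr (s / 2 - 1) * indicator {1..T} t))"
      using int int01 by (intro integrable_mult_right Bochner_Integration.integrable_add)
    fix t :: real
    have "indicator {0<..<T} t * (t powr (s / 2 - 1) * (1 - exp (- t)))
        \<le> indicator {0..1} t + t powr (s / 2 - 1) * indicator {1..T} t"
    proof -
      consider "t \<notin> {0<..<T}" | "0 < t" "t < 1" | "1 \<le> t" "t < T" by force
      then show ?thesis
      proof cases
        case 2
        have "t powr (s / 2 - 1) * (1 - exp (- t)) \<le> t powr (s / 2 - 1) * t"
          using exp_ge_add_one_self[of "- t"] by (intro mult_left_mono) auto
        also have "\<dots> = t powr (s / 2)" using 2 powr_add[of t "s / 2 - 1" 1] by simp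
        also have "\<dots> \<le> 1" using 2 s by (intro powr_le1) auto
        finally show ?thesis using 2 by (simp add: indicator_def)
      next
        case 3
        have "t powr (s / 2 - 1) * (1 - exp (- t)) \<le> t powr (s / 2 - 1) * 1"
          by (intro mult_left_mono) auto
        then show ?thesis using 3 by (auto simp: indicator_def intro: order_trans[OF _ exp_ge_zero])
      qed (auto simp: indicator_def)
    qed
    then have "1 / (2 * Gamma (s / 2 + 1)) * (indicator {0<..<T} t * (t powr (s / 2 - 1) * (1 - exp (- t))))
        \<le> 1 / (2 * Gamma (s / 2 + 1)) * (indicator {0..1} t + t powr (s / 2 - 1) * indicator {1..T} t)"
      using G by (intro mult_left_mono) auto
    then show "indicator {0<..<T} t * (mix s t * (gauss t (0::'a) - exp (- t)))
        \<le> 1 / (2 * Gamma (s / 2 + 1)) * (indicator {0..1} t + t powr (s / 2 - 1) * indicator {1..T} t)"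
      by (simp add: mix_def gauss_def mult_ac)
  qed
  also have "\<dots> = 1 / (2 * Gamma (s / 2 + 1)) * (1 + (F T - F 1))"
    using int int01 eq by simp
  also have "\<dots> \<le> 1 / (2 * Gamma (s / 2 + 1)) * (1 + F T)"
    using G s by (intro mult_left_mono) (auto simp: F_def)
  finally show ?thesis by (simp add: F_def)
qed

section \<open>Splitting the modulated energy\<close>

lemma riesz_low_le_0:
  fixes x :: "'a::euclidean_space"
  assumes "0 \<le> s" "0 < T"
  shows "riesz_low s T x \<le> riesz_low s T (0::'a)"
  unfolding riesz_low_def
  by (rule integral_mono[OF integrable_riesz_low integrable_riesz_low])
    (use assms mix_nonneg[OF assms(1)] in \<open>auto simp: gauss_def indicator_def intro!: mult_left_mono\<close>)

text \<open>Provides the absolute integrability that Fubini demands: without cancellation in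
  \<open>t\<close>, integrability of \<open>riesz_low\<close> itself is enough.\<close>

lemma abs_riesz_low:
  assumes "0 \<le> s"
  shows "\<bar>riesz_low s T x\<bar> = (\<integral>t. \<bar>indicator {0<..<T} t * (mix s t * (gauss t x - exp (- t)))\<bar> \<partial>lborel)"
proof -
  let ?f = "\<lambda>t. indicator {0<..<T} t * (mix s t * (gauss t x - exp (- t)))"
  \<comment> \<open>The integrand has a constant sign, determined by whether \<open>x\<close> lies in the unit ball.\<close>
  consider "norm x \<le> 1" | "1 \<le> norm x" by linarith
  then show ?thesis
  proof cases
    case 1
    then have "(norm x)\<^sup>2 \<le> 1" by (simp add: power_le_one)
    then have nn: "0 \<le> ?f t" for t
      using mix_nonneg[OF assms, of t] mult_left_mono[of "(norm x)\<^sup>2" 1 t] by (auto simp: indicator_def gauss_def)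
    then have "0 \<le> riesz_low s T x" unfolding riesz_low_def by (intro Bochner_Integration.integral_nonneg)
    then show ?thesis unfolding abs_of_nonneg[OF nn] by (simp add: riesz_low_def)
  next
    case 2
    then have "1 \<le> (norm x)\<^sup>2" by simp
    then have np: "?f t \<le> 0" for t
      using mix_nonneg[OF assms, of t] mult_left_mono[of 1 "(norm x)\<^sup>2" t]
      by (auto simp: indicator_def gauss_def intro!: mult_nonneg_nonpos)
    then have "0 \<le> (\<integral>t. - ?f t \<partial>lborel)" by (intro Bochner_Integration.integral_nonneg) simp
    then have "riesz_low s T x \<le> 0" by (simp add: riesz_low_def)
    then show ?thesis unfolding abs_of_nonpos[OF np] by (simp add: riesz_low_def)
  qed
qed

text \<open>The map \<open>\<psi>\<close> is general in order to cover both \<open>x - y\<close>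
  under \<open>\<mu>\<close> and \<open>fst p - snd p\<close> under the product measure. The term
  \<open>exp (- t)\<close> stays unchanged because \<open>\<nu>\<close> has mass one.\<close>

lemma integral_riesz_low_swap:
  fixes \<psi> :: "'b \<Rightarrow> 'a::euclidean_space"
  assumes "prob_space \<nu>" and [measurable]: "\<psi> \<in> borel_measurable \<nu>" and s: "0 \<le> s" and T: "0 < T"
    and int: "integrable \<nu> (\<lambda>p. riesz_low s T (\<psi> p))"
  shows "has_bochner_integral lborel
    (\<lambda>t. indicator {0<..<T} t * (mix s t * ((\<integral>p. gauss t (\<psi> p) \<partial>\<nu>) - exp (- t)))) (\<integral>p. riesz_low s T (\<psi> p) \<partial>\<nu>)"
proof -
  interpret prob_space \<nu> by fact
  interpret pair_sigma_finite \<nu> "lborel :: real measure" ..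
  let ?f = "\<lambda>p t. indicator {0<..<T} t * (mix s t * (gauss t (\<psi> p) - exp (- t)))"
  have meas: "(\<lambda>(p, t). ?f p t) \<in> borel_measurable (\<nu> \<Otimes>\<^sub>M lborel)"
    unfolding gauss_def by measurable
  have fint: "integrable (\<nu> \<Otimes>\<^sub>M lborel) (\<lambda>(p, t). ?f p t)"
  proof (rule Fubini_integrable[OF meas])
    show "integrable \<nu> (\<lambda>p. \<integral>t. norm (case (p, t) of (p, t) \<Rightarrow> ?f p t) \<partial>lborel)"
      using integrable_abs[OF int] by (simp add: abs_riesz_low[OF s])
    show "AE p in \<nu>. integrable lborel (\<lambda>t. case (p, t) of (p, t) \<Rightarrow> ?f p t)"
      by (intro AE_I2) (simp only: prod.case, rule integrable_riesz_low[OF s T])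
  qed
  have inner: "(\<integral>p. ?f p t \<partial>\<nu>) = indicator {0<..<T} t * (mix s t * ((\<integral>p. gauss t (\<psi> p) \<partial>\<nu>) - exp (- t)))" for t
  proof (cases "0 < t")
    case True
    then have "integrable \<nu> (\<lambda>p. gauss t (\<psi> p))"
      by (intro integrable_gauss finite_measure_axioms) auto
    then show ?thesis by (simp add: prob_space)
  qed simp
  have "integrable lborel (\<lambda>t. \<integral>p. ?f p t \<partial>\<nu>)" using integrable_snd[OF fint] .
  moreover have "(\<integral>t. (\<integral>p. ?f p t \<partial>\<nu>) \<partial>lborel) = (\<integral>p. riesz_low s T (\<psi> p) \<partial>\<nu>)"
    using Fubini_integral[OF fint] by (simp add: riesz_low_def)
  ultimately show ?thesis unfolding inner by (simp add: has_bochner_integral_iff)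
qed

text \<open>\<open>D\<close> is the bound on the density, in the form in which the estimates use it:
  domination of integrals by Lebesgue integrals.\<close>

locale riesz_gas = prob_space \<mu> for \<mu> :: "'a::euclidean_space measure" +
  fixes s D :: real
  assumes sets_eq [measurable_cong, simp]: "sets \<mu> = sets borel"
    and D_nonneg: "0 \<le> D"
    and nn_integral_le: "\<And>f. f \<in> borel_measurable borel \<Longrightarrow> (\<integral>\<^sup>+x. f x \<partial>\<mu>) \<le> ennreal D * (\<integral>\<^sup>+x. f x \<partial>lborel)"
    and s_nonneg: "0 \<le> s" and s_less: "s < real DIM('a) / 2"
    and log_integrable: "s = 0 \<Longrightarrow> (\<integral>\<^sup>+p. ennreal \<bar>ln (norm (fst p - snd p))\<bar> \<partial>(\<mu> \<Otimes>\<^sub>M \<mu>)) < \<infinity>"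
begin

lemma space_eq [simp]: "space \<mu> = UNIV"
  using sets_eq_imp_space_eq[OF sets_eq] by simp

lemma prob_UNIV [simp]: "prob UNIV = 1"
  using prob_space by simp

sublocale pair: pair_prob_space \<mu> \<mu> ..

lemma prob_space_pair: "prob_space (\<mu> \<Otimes>\<^sub>M \<mu>)"
  by (rule pair.P.prob_space_axioms)

lemma s_less_dim: "s < real DIM('a)"
  using s_less s_nonneg by (simp add: field_simps)

lemma AE_neq: "AE y in \<mu>. y \<noteq> x"
proof -
  have "emeasure \<mu> {x} \<le> ennreal D * emeasure lborel {x}"
    using nn_integral_le[of "indicator {x}"] by simp
  then have "{x} \<in> null_sets \<mu>" by (auto intro!: null_setsI)
  then show ?thesis by (rule AE_I') auto
qed

lemma AE_pair_neq: "AE p in \<mu> \<Otimes>\<^sub>M \<mu>. fst p \<noteq> snd p"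
proof (rule pair.AE_pair_measure)
  show "{p \<in> space (\<mu> \<Otimes>\<^sub>M \<mu>). fst p \<noteq> snd p} \<in> sets (\<mu> \<Otimes>\<^sub>M \<mu>)" by measurable
  have "AE y in \<mu>. x \<noteq> y" for x using AE_neq[of x] by eventually_elim auto
  then show "AE x in \<mu>. AE y in \<mu>. fst (x, y) \<noteq> snd (x, y)" by simp
qed

section \<open>High-frequency potential and energy\<close>

definition high_pot :: "real \<Rightarrow> 'a \<Rightarrow> real" where
  "high_pot T x = (\<integral>y. riesz_high s T (x - y) \<partial>\<mu>)"

definition high_energy :: "real \<Rightarrow> real" where
  "high_energy T = (\<integral>p. riesz_high s T (fst p - snd p) \<partial>(\<mu> \<Otimes>\<^sub>M \<mu>))"

definition high_bound :: "real \<Rightarrow> real" where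
  "high_bound T = D * (pi powr (real DIM('a) / 2) / (Gamma (s / 2 + 1) * (real DIM('a) - s))
     * T powr ((s - real DIM('a)) / 2))"

definition high_sq_bound :: "real \<Rightarrow> real" where
  "high_sq_bound T = D * (pi powr (real DIM('a) / 4) / (Gamma (s / 2 + 1) * (real DIM('a) / 2 - s))
     * T powr (s / 2 - real DIM('a) / 4))\<^sup>2"

lemma high_bound_nonneg: "0 \<le> high_bound T" and high_sq_bound_nonneg: "0 \<le> high_sq_bound T"
  using D_nonneg Gamma_real_pos[of "s / 2 + 1"] s_nonneg s_less_dim
  by (simp_all add: high_bound_def high_sq_bound_def)

lemma nn_integral_shifted_le:
  fixes f :: "'a \<Rightarrow> real"
  assumes [measurable]: "f \<in> borel_measurable borel" and sym: "\<And>x y. f (x - y) = f (y - x)"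
    and le: "(\<integral>\<^sup>+y. ennreal (f y) \<partial>lborel) \<le> ennreal c"
  shows "(\<integral>\<^sup>+y. ennreal (f (x - y)) \<partial>\<mu>) \<le> ennreal (D * c)"
proof -
  have "(\<integral>\<^sup>+y. ennreal (f (x - y)) \<partial>\<mu>) \<le> ennreal D * (\<integral>\<^sup>+y. ennreal (f (x - y)) \<partial>lborel)"
    by (rule nn_integral_le) measurable
  also have "\<dots> = ennreal D * (\<integral>\<^sup>+y. ennreal (f (y - x)) \<partial>lborel)"
    by (subst sym) simp
  also have "\<dots> = ennreal D * (\<integral>\<^sup>+y. ennreal (f y) \<partial>lborel)"
    by (subst nn_integral_lborel_shift) measurable
  also have "\<dots> \<le> ennreal D * ennreal c"
    by (intro mult_left_mono le) auto
  finally show ?thesis using D_nonneg by (simp add: ennreal_mult')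
qed

lemma integrable_nonneg_bounded:
  assumes "f \<in> borel_measurable M" "\<And>x. 0 \<le> f x" "(\<integral>\<^sup>+x. ennreal (f x) \<partial>M) \<le> ennreal c"
    and "0 \<le> c"
  shows "integrable M f" "(\<integral>x. f x \<partial>M) \<le> c"
proof -
  show i: "integrable M f"
    using assms by (intro integrableI_nonneg) (auto simp: le_less_trans[OF _ ennreal_less_top])
  show "(\<integral>x. f x \<partial>M) \<le> c"
    using assms nn_integral_eq_integral[OF i] by simp
qed

context
  fixes T :: real
  assumes T: "0 < T"
begin

lemma integrable_high: "integrable \<mu> (\<lambda>y. riesz_high s T (x - y))"
  and high_pot_le: "high_pot T x \<le> high_bound T"
proof -
  have "(\<integral>\<^sup>+y. ennreal (riesz_high s T (x - y)) \<partial>\<mu>) \<le> ennreal (high_bound T)"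
    unfolding high_bound_def
    by (rule nn_integral_shifted_le[OF measurable_riesz_high riesz_high_minus_commute
          nn_integral_riesz_high_le[OF s_nonneg s_less_dim T]])
  from integrable_nonneg_bounded[OF _ _ this high_bound_nonneg] riesz_high_nonneg[OF s_nonneg]
  show "integrable \<mu> (\<lambda>y. riesz_high s T (x - y))" "high_pot T x \<le> high_bound T"
    by (auto simp: high_pot_def)
qed

lemma high_pot_nonneg: "0 \<le> high_pot T x"
  unfolding high_pot_def by (intro Bochner_Integration.integral_nonneg riesz_high_nonneg s_nonneg)

lemma integrable_high_sq: "integrable \<mu> (\<lambda>y. (riesz_high s T (x - y))\<^sup>2)"
  and high_sq_le: "(\<integral>y. (riesz_high s T (x - y))\<^sup>2 \<partial>\<mu>) \<le> high_sq_bound T"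
proof -
  have "(\<integral>\<^sup>+y. ennreal ((riesz_high s T (x - y))\<^sup>2) \<partial>\<mu>) \<le> ennreal (high_sq_bound T)"
    unfolding high_sq_bound_def
    by (rule nn_integral_shifted_le[OF _ _ nn_integral_riesz_high_sq_le[OF s_nonneg s_less T]])
      (measurable, subst riesz_high_minus_commute, rule refl)
  from integrable_nonneg_bounded[OF _ _ this high_sq_bound_nonneg]
  show "integrable \<mu> (\<lambda>y. (riesz_high s T (x - y))\<^sup>2)"
    "(\<integral>y. (riesz_high s T (x - y))\<^sup>2 \<partial>\<mu>) \<le> high_sq_bound T"
    by auto
qed

lemma measurable_high_pot [measurable]: "high_pot T \<in> borel_measurable borel"
  unfolding high_pot_def by (rule borel_measurable_lebesgue_integral) measurable

lemma integrable_high_pot: "integrable \<mu> (high_pot T)"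
  by (rule integrable_const_bound[where B="high_bound T"])
    (use high_pot_nonneg high_pot_le in auto)

lemma integrable_high_pair: "integrable (\<mu> \<Otimes>\<^sub>M \<mu>) (\<lambda>p. riesz_high s T (fst p - snd p))"
  by (rule pair.Fubini_integrable)
    (use integrable_high integrable_high_pot in
      \<open>auto simp: high_pot_def[abs_def] abs_of_nonneg[OF riesz_high_nonneg[OF s_nonneg]]\<close>)

lemma high_energy_eq: "high_energy T = (\<integral>x. high_pot T x \<partial>\<mu>)"
  unfolding high_energy_def high_pot_def
  using pair.integral_fst'[OF integrable_high_pair] by simp

lemma high_energy_nonneg: "0 \<le> high_energy T"
  unfolding high_energy_eq by (intro Bochner_Integration.integral_nonneg high_pot_nonneg)

section \<open>Integrability of the full kernel and of its low-frequency part\<close>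

lemma riesz_kernel_le:
  "riesz_kernel s x \<le> \<bar>riesz_shift s T\<bar> + \<bar>riesz_low s T (0::'a)\<bar> + riesz_high s T (x::'a)"
proof (cases "x = 0")
  case True
  then show ?thesis using riesz_high_nonneg[OF s_nonneg, of T x] s_nonneg
    by (auto simp: riesz_kernel_def intro!: add_nonneg_nonneg)
next
  case False
  then show ?thesis
    using riesz_kernel_split[OF s_nonneg T False] riesz_low_le_0[OF s_nonneg T, of x]
      abs_ge_self[of "riesz_shift s T"] abs_ge_self[of "riesz_low s T (0::'a)"] by simp
qed

lemma measurable_riesz_kernel [measurable]: "(riesz_kernel s :: 'a \<Rightarrow> real) \<in> borel_measurable borel"
  unfolding riesz_kernel_def by measurable

lemma integrable_riesz_pair: "integrable (\<mu> \<Otimes>\<^sub>M \<mu>) (\<lambda>p. riesz_kernel s (fst p - snd p))"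
proof (cases "s = 0")
  case True
  then show ?thesis using log_integrable
    by (intro integrableI_bounded) (auto simp: riesz_kernel_def)
next
  case False
  show ?thesis
  proof (rule Bochner_Integration.integrable_bound)
    show "integrable (\<mu> \<Otimes>\<^sub>M \<mu>) (\<lambda>p. \<bar>riesz_shift s T\<bar> + \<bar>riesz_low s T (0::'a)\<bar> + riesz_high s T (fst p - snd p))"
      using integrable_high_pair by simp
    show "AE p in \<mu> \<Otimes>\<^sub>M \<mu>. norm (riesz_kernel s (fst p - snd p))
      \<le> norm (\<bar>riesz_shift s T\<bar> + \<bar>riesz_low s T (0::'a)\<bar> + riesz_high s T (fst p - snd p))"
    proof (rule AE_I2)
      fix p :: "'a \<times> 'a"
      have "0 \<le> riesz_kernel s (fst p - snd p)" using False s_nonneg by (simp add: riesz_kernel_def)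
      then show "norm (riesz_kernel s (fst p - snd p))
      \<le> norm (\<bar>riesz_shift s T\<bar> + \<bar>riesz_low s T (0::'a)\<bar> + riesz_high s T (fst p - snd p))"
        using riesz_kernel_le[of "fst p - snd p"] by simp
    qed
  qed measurable
qed

text \<open>Every \<open>x\<close> is needed, since potentials are evaluated at arbitrary points.
  For \<open>s > 0\<close> the kernel is nonnegative and dominated through
  \<open>riesz_kernel_le\<close>. For \<open>s = 0\<close> the hypothesis and Fubini supply one good
  point \<open>x0\<close>; the singularity at \<open>x\<close> is controlled by
  \<open>riesz_high\<close>, and growth at infinity is transferred from \<open>x0\<close> to
  \<open>x\<close>.\<close>

lemma integrable_riesz: "integrable \<mu> (\<lambda>y. riesz_kernel s (x - y))"
proof (cases "s = 0")
  case False
  show ?thesis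
  proof (rule Bochner_Integration.integrable_bound)
    show "integrable \<mu> (\<lambda>y. \<bar>riesz_shift s T\<bar> + \<bar>riesz_low s T (0::'a)\<bar> + riesz_high s T (x - y))"
      using integrable_high by simp
    show "AE y in \<mu>. norm (riesz_kernel s (x - y))
      \<le> norm (\<bar>riesz_shift s T\<bar> + \<bar>riesz_low s T (0::'a)\<bar> + riesz_high s T (x - y))"
    proof (rule AE_I2)
      fix y :: 'a
      have "0 \<le> riesz_kernel s (x - y)" using False s_nonneg by (simp add: riesz_kernel_def)
      then show "norm (riesz_kernel s (x - y))
      \<le> norm (\<bar>riesz_shift s T\<bar> + \<bar>riesz_low s T (0::'a)\<bar> + riesz_high s T (x - y))"
        using riesz_kernel_le[of "x - y"] by simp
    qed
  qed measurable
next
  case True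
  have "AE x in \<mu>. integrable \<mu> (\<lambda>y. riesz_kernel s (x - y))"
    using pair.AE_integrable_fst'[OF integrable_riesz_pair] by simp
  then have "\<exists>x0. integrable \<mu> (\<lambda>y. riesz_kernel s (x0 - y))"
    by (metis (mono_tags, lifting) AE_const eventually_mono)
  then obtain x0 where x0: "integrable \<mu> (\<lambda>y. riesz_kernel s (x0 - y))" by blast
  let ?K = "\<bar>riesz_shift s T\<bar> + \<bar>riesz_low s T (0::'a)\<bar>"
  let ?b = "\<lambda>y. ?K + riesz_high s T (x - y) + 2 * (ln (1 + norm (x - x0)) + ln 2 + \<bar>riesz_kernel s (x0 - y)\<bar>)"
  show ?thesis
  proof (rule Bochner_Integration.integrable_bound)
    show "integrable \<mu> ?b" using integrable_high x0 by simp
    show "AE y in \<mu>. norm (riesz_kernel s (x - y)) \<le> norm (?b y)"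
    proof (rule AE_I2)
      fix y
      \<comment> \<open>The modulus of \<open>ln\<close> is \<open>- ln\<close> plus twice its
        positive part; \<open>riesz_kernel_le\<close> bounds the former from above.\<close>
      have "\<bar>ln (norm v)\<bar> \<le> - ln (norm v) + 2 * ln (1 + norm v)" if "v \<noteq> 0" for v :: 'a
      proof (cases "1 \<le> norm v")
        case True
        then have "ln (norm v) \<le> ln (1 + norm v)" by (intro ln_mono) auto
        moreover have "0 \<le> ln (norm v)" using True by simp
        ultimately show ?thesis by simp
      next
        case False
        then have "ln (norm v) \<le> 0" using that by simp
        moreover have "0 \<le> ln (1 + norm v)" by simp
        ultimately show ?thesis by simp
      qed
      then have 1: "\<bar>riesz_kernel s v\<bar> \<le> ?K + riesz_high s T v + 2 * ln (1 + norm v)" for v :: 'a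
        using riesz_kernel_le[of v] riesz_high_nonneg[OF s_nonneg, of T v] True
        by (cases "v = 0") (force simp: riesz_kernel_def)+
      \<comment> \<open>Moving the base point from \<open>x0\<close> to \<open>x\<close> adds only a
        constant in \<open>y\<close>: \<open>1 + norm\<close> is submultiplicative under the
        triangle inequality.\<close>
      have "ln (1 + norm (x - y)) \<le> ln ((1 + norm (x - x0)) * (1 + norm (x0 - y)))"
      proof (rule ln_mono)
        have "norm (x - y) \<le> norm (x - x0) + norm (x0 - y)"
          using norm_triangle_ineq[of "x - x0" "x0 - y"] by simp
        moreover have "0 \<le> norm (x - x0) * norm (x0 - y)" by simp
        ultimately show "1 + norm (x - y) \<le> (1 + norm (x - x0)) * (1 + norm (x0 - y))"
          unfolding ring_distribs by linarith
      qed (auto intro: add_pos_nonneg)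
      also have "\<dots> = ln (1 + norm (x - x0)) + ln (1 + norm (x0 - y))"
        by (rule ln_mult_pos) (auto intro: add_pos_nonneg)
      also have "ln (1 + norm (x0 - y)) \<le> ln 2 + \<bar>ln (norm (x0 - y))\<bar>"
      proof (cases "1 \<le> norm (x0 - y)")
        case True
        then have "ln (1 + norm (x0 - y)) \<le> ln (2 * norm (x0 - y))" by (intro ln_mono) auto
        also have "\<dots> = ln 2 + ln (norm (x0 - y))" by (rule ln_mult_pos) (use True in auto)
        finally show ?thesis by simp
      next
        case False
        then have "ln (1 + norm (x0 - y)) \<le> ln 2" by (intro ln_mono) (auto intro: add_pos_nonneg)
        then show ?thesis by simp
      qed
      finally have "ln (1 + norm (x - y)) \<le> ln (1 + norm (x - x0)) + ln 2 + \<bar>riesz_kernel s (x0 - y)\<bar>"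
        using True by (simp add: riesz_kernel_def)
      then have "2 * ln (1 + norm (x - y)) \<le> 2 * (ln (1 + norm (x - x0)) + ln 2 + \<bar>riesz_kernel s (x0 - y)\<bar>)"
        by (intro mult_left_mono) auto
      from order_trans[OF 1[of "x - y"] add_left_mono[OF this]] have "\<bar>riesz_kernel s (x - y)\<bar> \<le> ?b y" .
      also have "\<dots> \<le> norm (?b y)" by (simp only: real_norm_def abs_ge_self)
      finally show "norm (riesz_kernel s (x - y)) \<le> norm (?b y)" by simp
    qed
  qed measurable
qed

lemma low_eq_AE: "AE y in \<mu>. riesz_kernel s (x - y) - riesz_shift s T - riesz_high s T (x - y) = riesz_low s T (x - y)"
  using AE_neq[of x] by eventually_elim (simp add: riesz_kernel_split[OF s_nonneg T])

lemma low_eq_AE_pair: "AE p in \<mu> \<Otimes>\<^sub>M \<mu>. riesz_kernel s (fst p - snd p) - riesz_shift s T - riesz_high s T (fst p - snd p)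
    = riesz_low s T (fst p - snd p)"
  using AE_pair_neq by eventually_elim (simp add: riesz_kernel_split[OF s_nonneg T])

lemma integrable_low: "integrable \<mu> (\<lambda>y. riesz_low s T (x - y))"
  by (rule integrable_cong_AE[THEN iffD1, OF _ _ low_eq_AE])
    (use integrable_riesz integrable_high in auto)

lemma integrable_low_pair: "integrable (\<mu> \<Otimes>\<^sub>M \<mu>) (\<lambda>p. riesz_low s T (fst p - snd p))"
  by (rule integrable_cong_AE[THEN iffD1, OF _ _ low_eq_AE_pair])
    (use integrable_riesz_pair integrable_high_pair pair.P.prob_space_axioms in auto)

section \<open>The modulated energy in terms of the two parts\<close>

definition low_pot :: "'a \<Rightarrow> real" where
  "low_pot x = (\<integral>y. riesz_low s T (x - y) \<partial>\<mu>)"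

definition low_energy :: real where
  "low_energy = (\<integral>p. riesz_low s T (fst p - snd p) \<partial>(\<mu> \<Otimes>\<^sub>M \<mu>))"

lemma potential_eq: "potential s \<mu> x = riesz_shift s T + low_pot x + high_pot T x"
proof -
  have "low_pot x = (\<integral>y. riesz_kernel s (x - y) - riesz_shift s T - riesz_high s T (x - y) \<partial>\<mu>)"
    unfolding low_pot_def by (rule integral_cong_AE[symmetric]) (use low_eq_AE in auto)
  also have "\<dots> = potential s \<mu> x - riesz_shift s T - high_pot T x"
    using integrable_riesz integrable_high by (simp add: potential_def high_pot_def prob_space)
  finally show ?thesis by simp
qed

lemma self_energy_eq: "2 * self_energy s \<mu> = riesz_shift s T + low_energy + high_energy T"
proof -
  have "low_energy = (\<integral>p. riesz_kernel s (fst p - snd p) - riesz_shift s T - riesz_high s T (fst p - snd p) \<partial>(\<mu> \<Otimes>\<^sub>M \<mu>))"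
    unfolding low_energy_def by (rule integral_cong_AE[symmetric]) (use low_eq_AE_pair in auto)
  also have "\<dots> = 2 * self_energy s \<mu> - riesz_shift s T - high_energy T"
    using integrable_riesz_pair integrable_high_pair
    by (simp add: self_energy_def high_energy_def pair.P.prob_space)
  finally show ?thesis by simp
qed

text \<open>The subtracted \<open>exp (- t)\<close> enters with coefficient
  \<open>n\<^sup>2 - 2 * n * n + n\<^sup>2 = 0\<close>, since the signed measure has total mass
  zero. What remains is the Gaussian form integrated against a nonnegative weight.\<close>

lemma fluctuation_form_low_nonneg: "0 \<le> fluctuation_form \<mu> n X (riesz_low s T)"
proof -
  let ?w = "\<lambda>t. indicator {0<..<T} t * mix s t :: real"
  have pt: "has_bochner_integral lborel (\<lambda>t. indicator {0<..<T} t * (mix s t * (gauss t x - exp (- t)))) (riesz_low s T x)" for x :: 'a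
    using integrable_riesz_low[OF s_nonneg T, of x] by (simp add: has_bochner_integral_iff riesz_low_def)
  have one: "has_bochner_integral lborel
      (\<lambda>t. indicator {0<..<T} t * (mix s t * ((\<integral>y. gauss t (x - y) \<partial>\<mu>) - exp (- t)))) (\<integral>y. riesz_low s T (x - y) \<partial>\<mu>)" for x
    by (rule integral_riesz_low_swap[OF prob_space_axioms _ s_nonneg T integrable_low]) measurable
  have two: "has_bochner_integral lborel
      (\<lambda>t. indicator {0<..<T} t * (mix s t * ((\<integral>p. gauss t (fst p - snd p) \<partial>(\<mu> \<Otimes>\<^sub>M \<mu>)) - exp (- t))))
      (\<integral>p. riesz_low s T (fst p - snd p) \<partial>(\<mu> \<Otimes>\<^sub>M \<mu>))"
    by (rule integral_riesz_low_swap[OF prob_space_pair _ s_nonneg T integrable_low_pair]) measurable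
  let ?f = "\<lambda>t. (\<Sum>i\<in>{1..n}. \<Sum>j\<in>{1..n}. indicator {0<..<T} t * (mix s t * (gauss t (X i - X j) - exp (- t))))
      - 2 * real n * (\<Sum>i\<in>{1..n}. indicator {0<..<T} t * (mix s t * ((\<integral>y. gauss t (X i - y) \<partial>\<mu>) - exp (- t))))
      + (real n)\<^sup>2 * (indicator {0<..<T} t * (mix s t * ((\<integral>p. gauss t (fst p - snd p) \<partial>(\<mu> \<Otimes>\<^sub>M \<mu>)) - exp (- t))))"
  have "has_bochner_integral lborel ?f (fluctuation_form \<mu> n X (riesz_low s T))"
    unfolding fluctuation_form_def
    by (intro has_bochner_integral_add has_bochner_integral_diff has_bochner_integral_mult_right
        has_bochner_integral_sum pt one two)
  moreover have "0 \<le> ?f t" for t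
  proof -
    have "?f t = ?w t * fluctuation_form \<mu> n X (gauss t)"
      unfolding fluctuation_form_def mult.assoc[symmetric] right_diff_distrib sum_subtractf
      by (simp add: sum_distrib_left[symmetric] algebra_simps power2_eq_square)
    then show ?thesis
      using fluctuation_form_gauss_nonneg[OF prob_space_axioms sets_eq, of t n X] mix_nonneg[OF s_nonneg, of t]
      by (auto simp: indicator_def)
  qed
  ultimately show ?thesis
    by (metis (no_types, lifting) Bochner_Integration.integral_nonneg has_bochner_integral_integral_eq)
qed

definition high_kernel :: "'a \<Rightarrow> 'a \<Rightarrow> real" where
  "high_kernel x y = riesz_high s T (x - y) - high_pot T x - high_pot T y + high_energy T"

lemma high_kernel_sym: "high_kernel x y = high_kernel y x"
  by (simp add: high_kernel_def riesz_high_minus_commute[of s T x y])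

lemma high_kernel_ge: "- 2 * high_bound T \<le> high_kernel x y"
  using riesz_high_nonneg[OF s_nonneg, of T "x - y"] high_pot_le[of x] high_pot_le[of y] high_energy_nonneg
  by (simp add: high_kernel_def)

text \<open>The unbounded diagonal terms \<open>- 2 * low_pot (X i)\<close> of the low-frequency part cancel
  against the term \<open>- (1 / N\<^sup>2) * (\<Sum>i. potential s \<mu> (X i))\<close> of the modulated energy.\<close>

lemma neg_modulated_energy_le:
  assumes N: "1 \<le> N" and X: "inj_on X {1..N}"
  shows "- (real N * modulated_energy s N X \<mu>)
    \<le> (riesz_low s T (0::'a) + riesz_shift s T) / 2 + high_bound T
      - (\<Sum>j\<in>{1..N}. \<Sum>i\<in>{1..<j}. high_kernel (X i) (X j)) / real N"
proof -
  define P where "P = (\<Sum>j\<in>{1..N}. \<Sum>i\<in>{1..<j}. high_kernel (X i) (X j))"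
  define L where "L = (\<Sum>i\<in>{1..N}. low_pot (X i))"
  define H where "H = (\<Sum>i\<in>{1..N}. high_pot T (X i))"
  define a where "a x y = riesz_low s T (x - y) - low_pot x - low_pot y + low_energy" for x y
  define A where "A = fluctuation_form \<mu> N X (riesz_low s T)"
  have N0: "0 < real N" using N by simp
  have ck: "centered_kernel s \<mu> (X i) (X j) = a (X i) (X j) + high_kernel (X i) (X j)"
    if "i \<in> {1..N}" "j \<in> {1..N} - {i}" for i j
  proof -
    have "X i - X j \<noteq> 0" using X that by (auto dest: inj_onD)
    from riesz_kernel_split[OF s_nonneg T this] show ?thesis
      unfolding centered_kernel_def a_def high_kernel_def potential_eq self_energy_eq by simp
  qed
  have offdiag: "(\<Sum>i\<in>{1..N}. \<Sum>j\<in>{1..N} - {i}. f i j) = (\<Sum>i\<in>{1..N}. \<Sum>j\<in>{1..N}. f i j) - (\<Sum>i\<in>{1..N}. f i i)"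
    for f :: "nat \<Rightarrow> nat \<Rightarrow> real"
    by (subst sum_subtractf[symmetric]) (auto intro!: sum.cong simp: sum_diff1)
  have "(\<Sum>i\<in>{1..N}. \<Sum>j\<in>{1..N} - {i}. centered_kernel s \<mu> (X i) (X j))
      = (\<Sum>i\<in>{1..N}. \<Sum>j\<in>{1..N} - {i}. a (X i) (X j)) + (\<Sum>i\<in>{1..N}. \<Sum>j\<in>{1..N} - {i}. high_kernel (X i) (X j))"
    unfolding sum.distrib[symmetric] by (intro sum.cong refl ck)
  also have "(\<Sum>i\<in>{1..N}. \<Sum>j\<in>{1..N} - {i}. high_kernel (X i) (X j)) = 2 * P"
    unfolding offdiag P_def by (subst sum_square_split) (auto intro: high_kernel_sym)
  also have "(\<Sum>i\<in>{1..N}. \<Sum>j\<in>{1..N} - {i}. a (X i) (X j)) = A - (real N * riesz_low s T (0::'a) - 2 * L + real N * low_energy)"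
    unfolding offdiag A_def fluctuation_form_def a_def L_def low_pot_def[symmetric] low_energy_def[symmetric]
    by (simp add: sum.distrib sum_subtractf sum_distrib_left[symmetric] power2_eq_square algebra_simps)
  finally have S: "(\<Sum>i\<in>{1..N}. \<Sum>j\<in>{1..N} - {i}. centered_kernel s \<mu> (X i) (X j))
    = A - (real N * riesz_low s T (0::'a) - 2 * L + real N * low_energy) + 2 * P" .
  have pot: "(\<Sum>i\<in>{1..N}. potential s \<mu> (X i)) = real N * riesz_shift s T + L + H"
    by (simp add: potential_eq sum.distrib L_def H_def)
  \<comment> \<open>\<open>low_energy\<close> cancels as well, between the diagonal of the low part
    and \<open>self_energy\<close>.\<close>
  have "- (real N * modulated_energy s N X \<mu>) = - A / (2 * real N)
      + (riesz_low s T (0::'a) + riesz_shift s T) / 2 - high_energy T / 2 + H / real N - P / real N"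
    unfolding modulated_energy_def S pot using self_energy_eq N0
    by (simp add: field_simps power2_eq_square)
  moreover have "0 \<le> A / (2 * real N)"
    using fluctuation_form_low_nonneg N0 by (simp add: A_def)
  moreover have "H / real N \<le> high_bound T"
  proof -
    have "H \<le> (\<Sum>i\<in>{1..N}. high_bound T)" unfolding H_def by (intro sum_mono high_pot_le)
    then show ?thesis using N0 by (simp add: field_simps)
  qed
  ultimately show ?thesis using high_energy_nonneg by (simp add: P_def)
qed

text \<open>The factor 2 comes from \<open>high_kernel_ge\<close>. The factor 16 is
  \<open>4 * 4\<close>: the square of four summands is at most four times the sum of squares, and
  each square integrates to at most \<open>high_sq_bound T\<close>, for potential and energy by
  Jensen (a variance is nonnegative).\<close>

lemma degenerate_high_kernel:
  assumes \<beta>: "0 \<le> \<beta>" "2 * \<beta> * high_bound T \<le> 1 / 2" "16 * \<beta>\<^sup>2 * high_sq_bound T \<le> 1 / 256"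
  shows "degenerate_kernel \<mu> (\<lambda>x y. - \<beta> * high_kernel x y) (1 / 2) (1 / 256)"
proof
  show "(\<lambda>(x, y). - \<beta> * high_kernel x y) \<in> borel_measurable (\<mu> \<Otimes>\<^sub>M \<mu>)"
    unfolding high_kernel_def by measurable
  fix x
  show "(\<integral>y. - \<beta> * high_kernel x y \<partial>\<mu>) = 0"
    unfolding high_kernel_def using integrable_high integrable_high_pot
    by (simp add: high_pot_def[symmetric] high_energy_eq prob_space)
  let ?b = "\<lambda>y. 4 * \<beta>\<^sup>2 * ((riesz_high s T (x - y))\<^sup>2 + (high_pot T x)\<^sup>2 + (high_pot T y)\<^sup>2 + (high_energy T)\<^sup>2)"
  have sq_pot: "(high_pot T y)\<^sup>2 \<le> high_sq_bound T" for y
  proof -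
    have "(high_pot T y)\<^sup>2 \<le> (\<integral>z. (riesz_high s T (y - z))\<^sup>2 \<partial>\<mu>)"
    proof -
      have "0 \<le> (\<integral>z. (riesz_high s T (y - z) - high_pot T y)\<^sup>2 \<partial>\<mu>)" by simp
      also have "\<dots> = (\<integral>z. (riesz_high s T (y - z))\<^sup>2 - 2 * high_pot T y * riesz_high s T (y - z) + (high_pot T y)\<^sup>2 \<partial>\<mu>)"
        by (rule Bochner_Integration.integral_cong[OF refl]) (simp add: power2_diff)
      also have "\<dots> = (\<integral>z. (riesz_high s T (y - z))\<^sup>2 \<partial>\<mu>) - 2 * high_pot T y * high_pot T y + (high_pot T y)\<^sup>2"
        using integrable_high integrable_high_sq by (simp add: prob_space high_pot_def[symmetric])
      finally show ?thesis by (simp add: power2_eq_square)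
    qed
    then show ?thesis using high_sq_le[of y] by simp
  qed
  have int_sq_pot: "integrable \<mu> (\<lambda>y. (high_pot T y)\<^sup>2)"
    by (rule integrable_const_bound[where B="high_sq_bound T"]) (use sq_pot in auto)
  have energy_sq: "(high_energy T)\<^sup>2 \<le> high_sq_bound T"
  proof -
    have "0 \<le> (\<integral>z. (high_pot T z - high_energy T)\<^sup>2 \<partial>\<mu>)" by simp
    also have "\<dots> = (\<integral>z. (high_pot T z)\<^sup>2 - 2 * high_energy T * high_pot T z + (high_energy T)\<^sup>2 \<partial>\<mu>)"
      by (rule Bochner_Integration.integral_cong[OF refl]) (simp add: power2_diff)
    also have "\<dots> = (\<integral>z. (high_pot T z)\<^sup>2 \<partial>\<mu>) - 2 * high_energy T * high_energy T + (high_energy T)\<^sup>2"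
      using integrable_high_pot int_sq_pot by (simp add: prob_space high_energy_eq[symmetric])
    finally have "(high_energy T)\<^sup>2 \<le> (\<integral>z. (high_pot T z)\<^sup>2 \<partial>\<mu>)" by (simp add: power2_eq_square)
    also have "\<dots> \<le> (\<integral>z. high_sq_bound T \<partial>\<mu>)" by (intro integral_mono int_sq_pot sq_pot) auto
    finally show ?thesis by (simp add: prob_space)
  qed
  have int_b: "integrable \<mu> ?b" using integrable_high_sq int_sq_pot by simp
  have le_b: "(- \<beta> * high_kernel x y)\<^sup>2 \<le> ?b y" for y
  proof -
    have four: "(a - b - c + d)\<^sup>2 \<le> 4 * (a\<^sup>2 + b\<^sup>2 + c\<^sup>2 + d\<^sup>2)" for a b c d :: real
    proof -
      \<comment> \<open>Lagrange's identity: these six squares are the defect in Cauchy-Schwarz for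
        \<open>(a, - b, - c, d)\<close> against \<open>(1, 1, 1, 1)\<close>.\<close>
      have "0 \<le> (a + b)\<^sup>2 + (a + c)\<^sup>2 + (a - d)\<^sup>2 + (b - c)\<^sup>2 + (b + d)\<^sup>2 + (c + d)\<^sup>2" by simp
      then show ?thesis by (simp add: power2_eq_square algebra_simps)
    qed
    have "\<beta>\<^sup>2 * (high_kernel x y)\<^sup>2 \<le> \<beta>\<^sup>2 * (4 * ((riesz_high s T (x - y))\<^sup>2 + (high_pot T x)\<^sup>2 + (high_pot T y)\<^sup>2 + (high_energy T)\<^sup>2))"
      unfolding high_kernel_def by (intro mult_left_mono four) auto
    also have "\<dots> = ?b y" by (simp only: mult_ac)
    finally show ?thesis by (simp add: power_mult_distrib)
  qed
  have [measurable]: "high_kernel x \<in> borel_measurable \<mu>" unfolding high_kernel_def by measurable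
  show int: "integrable \<mu> (\<lambda>y. (- \<beta> * high_kernel x y)\<^sup>2)"
    by (rule Bochner_Integration.integrable_bound[OF int_b])
      (use le_b in \<open>auto simp del: mult_minus_left intro: order_trans[OF _ abs_ge_self]\<close>)
  have "(\<integral>y. (- \<beta> * high_kernel x y)\<^sup>2 \<partial>\<mu>) \<le> (\<integral>y. ?b y \<partial>\<mu>)"
    by (intro integral_mono int int_b le_b)
  also have "\<dots> = 4 * \<beta>\<^sup>2 * ((\<integral>y. (riesz_high s T (x - y))\<^sup>2 \<partial>\<mu>) + (high_pot T x)\<^sup>2 + (\<integral>y. (high_pot T y)\<^sup>2 \<partial>\<mu>) + (high_energy T)\<^sup>2)"
    using integrable_high_sq int_sq_pot by (simp add: prob_space)
  also have "\<dots> \<le> 4 * \<beta>\<^sup>2 * (high_sq_bound T + high_sq_bound T + high_sq_bound T + high_sq_bound T)"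
  proof (intro mult_left_mono add_mono high_sq_le sq_pot energy_sq)
    have "(\<integral>y. (high_pot T y)\<^sup>2 \<partial>\<mu>) \<le> (\<integral>z. high_sq_bound T \<partial>\<mu>)" by (intro integral_mono int_sq_pot sq_pot) auto
    then show "(\<integral>y. (high_pot T y)\<^sup>2 \<partial>\<mu>) \<le> high_sq_bound T" by (simp add: prob_space)
  qed simp
  also have "\<dots> \<le> 1 / 256" using \<beta>(3) by simp
  finally show "(\<integral>y. (- \<beta> * high_kernel x y)\<^sup>2 \<partial>\<mu>) \<le> 1 / 256" .
  fix y
  show "- \<beta> * high_kernel x y = - \<beta> * high_kernel y x" using high_kernel_sym[of x y] by simp
  have "\<beta> * (- 2 * high_bound T) \<le> \<beta> * high_kernel x y" by (intro mult_left_mono high_kernel_ge \<beta>)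
  then show "- \<beta> * high_kernel x y \<le> 1 / 2" using \<beta>(2) by simp
qed

end

end

section \<open>Bounds on the partition function\<close>

lemma energy_rate_ge_1:
  assumes "0 \<le> s" "1 \<le> N"
  shows "1 \<le> energy_rate d s N"
proof (cases "s = 0")
  case True
  have "ln (exp 1) \<le> ln (exp 1 + real N)" by (intro ln_mono) auto
  then show ?thesis using True by (simp add: energy_rate_def)
next
  case False
  then show ?thesis using assms by (auto simp: energy_rate_def intro!: ge_one_powr_ge_zero)
qed

lemma log_ennreal_le:
  assumes "K \<le> ennreal (exp c)"
  shows "log_ennreal K \<le> ereal c"
proof (cases "K = 0")
  case False
  have fin: "K < \<infinity>" using assms by (simp add: le_less_trans)
  then have pos: "0 < enn2real K" using False by (simp add: enn2real_positive_iff zero_less_iff_neq_zero)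
  have "enn2real K \<le> exp c" using assms by (intro enn2real_leI) auto
  then have "ln (enn2real K) \<le> c" using pos by (metis exp_gt_zero ln_exp ln_le_cancel_iff)
  then show ?thesis using False fin by (auto simp: log_ennreal_def)
qed (simp add: log_ennreal_def)

context riesz_gas
begin

text \<open>\<open>riesz_kernel_split\<close> fails at the origin, where the kernel has a default
  value, so coinciding points must be excluded. In the induction a new coordinate has to avoid
  finitely many values, which is almost sure by \<open>AE_neq\<close>.\<close>

lemma AE_PiM_inj_on:
  assumes "finite I"
  shows "AE X in Pi\<^sub>M I (\<lambda>_. \<mu>). inj_on X I"
proof -
  interpret P: product_sigma_finite "\<lambda>_. \<mu>" ..
  let ?f = "\<lambda>I X. if inj_on X I then 0 else 1 :: ennreal"
  have meas: "?f I \<in> borel_measurable (Pi\<^sub>M I (\<lambda>_. \<mu>))" if "finite I" for I :: "'b set"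
  proof -
    have pred: "Measurable.pred (Pi\<^sub>M I (\<lambda>_. \<mu>)) (\<lambda>X. \<forall>i\<in>I. \<forall>j\<in>I. X i = X j \<longrightarrow> i = j)"
    proof (intro pred_intros_finite(3) that)
      fix i j assume "i \<in> I" "j \<in> I"
      then have "(\<lambda>X. X k) \<in> borel_measurable (Pi\<^sub>M I (\<lambda>_. \<mu>))" if "k = i \<or> k = j" for k
        using measurable_component_singleton[of k I "\<lambda>_. \<mu>"] that
        by (auto simp: measurable_cong_sets[OF refl sets_eq])
      then have "Measurable.pred (Pi\<^sub>M I (\<lambda>_. \<mu>)) (\<lambda>X. X i = X j)"
        unfolding pred_def by (intro measurable_equality_set) auto
      then show "Measurable.pred (Pi\<^sub>M I (\<lambda>_. \<mu>)) (\<lambda>X. X i = X j \<longrightarrow> i = j)"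
        by (cases "i = j") auto
    qed
    then show ?thesis unfolding inj_on_def by (intro measurable_If) auto
  qed
  have "(\<integral>\<^sup>+X. ?f I X \<partial>Pi\<^sub>M I (\<lambda>_. \<mu>)) = 0"
    using assms
  proof (induction I)
    case (insert k I)
    have "(\<integral>\<^sup>+X. ?f (insert k I) X \<partial>Pi\<^sub>M (insert k I) (\<lambda>_. \<mu>))
        = (\<integral>\<^sup>+X. \<integral>\<^sup>+y. ?f (insert k I) (X(k := y)) \<partial>\<mu> \<partial>Pi\<^sub>M I (\<lambda>_. \<mu>))"
      using insert.hyps meas[of "insert k I"] by (intro P.product_nn_integral_insert) auto
    also have "\<dots> \<le> (\<integral>\<^sup>+X. ?f I X \<partial>Pi\<^sub>M I (\<lambda>_. \<mu>))"
    proof (rule nn_integral_mono)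
      fix X
      have "AE y in \<mu>. \<forall>i\<in>I. y \<noteq> X i" using insert.hyps AE_neq by (auto intro!: AE_finite_allI)
      then have "AE y in \<mu>. ?f (insert k I) (X(k := y)) \<le> ?f I X"
      proof eventually_elim
        case (elim y)
        have "inj_on (X(k := y)) I = inj_on X I" using insert.hyps by (intro inj_on_cong) auto
        then show ?case using elim insert.hyps by auto
      qed
      then have "(\<integral>\<^sup>+y. ?f (insert k I) (X(k := y)) \<partial>\<mu>) \<le> (\<integral>\<^sup>+y. ?f I X \<partial>\<mu>)"
        by (rule nn_integral_mono_AE)
      also have "\<dots> = ?f I X" by (simp add: emeasure_space_1[unfolded space_eq])
      finally show "(\<integral>\<^sup>+y. ?f (insert k I) (X(k := y)) \<partial>\<mu>) \<le> ?f I X" .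
    qed
    finally show ?case using insert.IH by simp
  qed (simp add: P.nn_integral_empty)
  then have "AE X in Pi\<^sub>M I (\<lambda>_. \<mu>). ?f I X = 0"
    using nn_integral_0_iff_AE[OF meas[OF assms]] by simp
  then show ?thesis by eventually_elim (simp split: if_splits)
qed

text \<open>No randomness is used: each of at most \<open>N\<^sup>2\<close> pairs is bounded through
  \<open>high_kernel_ge\<close>, which after division by \<open>N\<close> leaves
  \<open>2 * N * high_bound T\<close>. For \<open>s > 0\<close> the chosen cutoff balances this, of
  order \<open>N * T powr ((s - d) / 2)\<close>, with the diagonal cost of order
  \<open>T powr (s / 2)\<close>.\<close>

lemma neg_modulated_energy_rate:
  "\<exists>R\<ge>0. \<forall>N\<ge>1. \<forall>X. inj_on X {1..N} \<longrightarrow> - (real N * modulated_energy s N X \<mu>) \<le> R * energy_rate DIM('a) s N"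
proof -
  let ?d = "real DIM('a)"
  define c where "c = 1 / (2 * Gamma (s / 2 + 1))"
  define c1 where "c1 = D * (pi powr (?d / 2) / (Gamma (s / 2 + 1) * (?d - s)))"
  define k where "k = (if s = 0 then 2 else 2 / s)"
  have G: "0 < Gamma (s / 2 + 1)" using s_nonneg by (simp add: Gamma_real_pos)
  have c: "0 \<le> c" using G by (simp add: c_def)
  have c1: "0 \<le> c1" using G D_nonneg s_less_dim by (simp add: c1_def)
  have k: "0 \<le> k" using s_nonneg by (simp add: k_def)
  have d: "0 < ?d" by simp
  \<comment> \<open>\<open>c\<close> and \<open>k\<close> come from \<open>riesz_low_0_le\<close>,
    and \<open>c1\<close> from \<open>high_bound\<close>. The factor 3 counts
    \<open>high_bound T\<close> once on its own and twice from the pair sum.\<close>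
  define R where "R = (c * (1 + k) + \<bar>riesz_profile s 1\<bar>) / 2 + 3 * c1"
  have "- (real N * modulated_energy s N X \<mu>) \<le> R * energy_rate DIM('a) s N"
    if N: "1 \<le> N" and X: "inj_on X {1..N}" for N X
  proof -
    let ?a = "energy_rate DIM('a) s N"
    have a1: "1 \<le> ?a" using energy_rate_ge_1 s_nonneg N by blast
    have N0: "0 < real N" using N by simp
    \<comment> \<open>The cutoff matches the typical interparticle distance \<open>T powr (- 1 / 2) = N powr (- 1 / d)\<close>.\<close>
    define T where "T = real N powr (2 / ?d)"
    have T: "1 \<le> T" using N by (simp add: T_def ge_one_powr_ge_zero)
    then have T0: "0 < T" by simp
    have rate: "real N powr (s / ?d) \<le> ?a"
    proof (cases "s = 0")
      case True then show ?thesis using a1 N0 by simp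
    qed (simp add: energy_rate_def)
    have low: "riesz_low s T (0::'a) \<le> c * (1 + k) * ?a"
    proof -
      have "(if s = 0 then ln T else 2 / s * T powr (s / 2)) \<le> k * ?a"
      proof (cases "s = 0")
        case True
        have "ln T = 2 / ?d * ln (real N)" by (simp add: T_def ln_powr)
        also have "\<dots> \<le> 2 * ln (exp 1 + real N)"
        proof (rule mult_mono)
          show "2 / ?d \<le> 2" using DIM_positive[where 'a='a] by (simp add: field_simps)
          show "ln (real N) \<le> ln (exp 1 + real N)" using N0 by (intro ln_mono) auto
        qed (use N in auto)
        finally show ?thesis using True by (simp add: k_def energy_rate_def)
      next
        case False
        have "T powr (s / 2) = real N powr (s / ?d)" by (simp add: T_def powr_powr)
        then show ?thesis using False by (simp add: k_def energy_rate_def)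
      qed
      then have "c * (1 + (if s = 0 then ln T else 2 / s * T powr (s / 2))) \<le> c * (?a + k * ?a)"
        using c a1 by (intro mult_left_mono add_mono) auto
      then show ?thesis
        using riesz_low_0_le[OF s_nonneg T, where 'a='a] by (simp add: c_def algebra_simps)
    qed
    have shift: "riesz_shift s T \<le> \<bar>riesz_profile s 1\<bar> * ?a"
    proof -
      have "0 \<le> (\<integral>t. indicator {T..} t * (mix s t * exp (- t)) \<partial>lborel)"
        by (intro Bochner_Integration.integral_nonneg mult_nonneg_nonneg mix_nonneg s_nonneg) auto
      then have "riesz_shift s T \<le> \<bar>riesz_profile s 1\<bar> * 1" by (simp add: riesz_shift_def)
      also have "\<dots> \<le> \<bar>riesz_profile s 1\<bar> * ?a" using a1 by (intro mult_left_mono) auto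
      finally show ?thesis .
    qed
    have high: "real N * high_bound T \<le> c1 * ?a"
    proof -
      have e: "2 / ?d * ((s - ?d) / 2) = s / ?d - 1" using d by (simp add: field_simps)
      have "real N * T powr ((s - ?d) / 2) = real N powr (s / ?d)"
        unfolding T_def powr_powr e using N0 by (simp add: powr_diff)
      then have "real N * high_bound T = c1 * real N powr (s / ?d)"
        by (simp add: high_bound_def c1_def mult_ac)
      then show ?thesis using rate c1 by (simp add: mult_left_mono)
    qed
    have high1: "high_bound T \<le> real N * high_bound T"
      using N high_bound_nonneg[of T] mult_right_mono[of 1 "real N" "high_bound T"] by simp
    have "(\<Sum>j\<in>{1..N}. \<Sum>i\<in>{1..<j}. - high_kernel T (X i) (X j)) \<le> (\<Sum>j\<in>{1..N}. real N * (2 * high_bound T))"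
    proof (rule sum_mono)
      fix j assume j: "j \<in> {1..N}"
      have "(\<Sum>i\<in>{1..<j}. - high_kernel T (X i) (X j)) \<le> (\<Sum>i\<in>{1..<j}. 2 * high_bound T)"
        using high_kernel_ge[OF T0] by (intro sum_mono) (simp add: minus_le_iff)
      also have "\<dots> = real (j - 1) * (2 * high_bound T)" by simp
      also have "\<dots> \<le> real N * (2 * high_bound T)"
        using j high_bound_nonneg by (intro mult_right_mono) auto
      finally show "(\<Sum>i\<in>{1..<j}. - high_kernel T (X i) (X j)) \<le> real N * (2 * high_bound T)" .
    qed
    then have "- (\<Sum>j\<in>{1..N}. \<Sum>i\<in>{1..<j}. high_kernel T (X i) (X j)) \<le> real N * (2 * (real N * high_bound T))"
      by (simp add: sum_negf mult_ac)
    then have pair: "- ((\<Sum>j\<in>{1..N}. \<Sum>i\<in>{1..<j}. high_kernel T (X i) (X j)) / real N) \<le> 2 * (real N * high_bound T)"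
      using N0 by (simp add: field_simps)
    have "R * ?a = (c * (1 + k) * ?a + \<bar>riesz_profile s 1\<bar> * ?a) / 2 + 3 * (c1 * ?a)"
      by (simp add: R_def field_simps)
    have combine: "F \<le> Z" if "F \<le> (l + h) / 2 + q - p" "l \<le> u" "h \<le> v" "n \<le> w" "q \<le> n" "- p \<le> 2 * n"
        "Z = (u + v) / 2 + 3 * w" for F Z l h q p u v w n :: real
      using that by argo
    show ?thesis
      by (rule combine[OF neg_modulated_energy_le[OF T0 N X] low shift high high1 pair]) fact
  qed
  moreover have "0 \<le> R" using c c1 k by (simp add: R_def)
  ultimately show ?thesis by blast
qed

lemma high_bounds_small:
  assumes "0 < \<epsilon>"
  shows "\<exists>T>0. high_bound T \<le> \<epsilon> \<and> high_sq_bound T \<le> \<epsilon>"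
proof -
  let ?d = "real DIM('a)"
  have 1: "(high_bound \<longlongrightarrow> 0) at_top"
  proof -
    have "((\<lambda>T. T powr ((s - ?d) / 2)) \<longlongrightarrow> 0) at_top"
      using s_less_dim by (intro tendsto_neg_powr filterlim_ident) auto
    from tendsto_mult_right_zero[OF tendsto_mult_right_zero[OF this]] show ?thesis
      unfolding high_bound_def[abs_def] .
  qed
  have 2: "(high_sq_bound \<longlongrightarrow> 0) at_top"
  proof -
    have "((\<lambda>T. T powr (s / 2 - ?d / 4)) \<longlongrightarrow> 0) at_top"
      using s_less by (intro tendsto_neg_powr filterlim_ident) auto
    from tendsto_power[OF tendsto_mult_right_zero[OF this], of _ 2]
    have "((\<lambda>T. (c * T powr (s / 2 - ?d / 4))\<^sup>2) \<longlongrightarrow> 0) at_top" for c by simp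
    then show ?thesis unfolding high_sq_bound_def[abs_def] by (rule tendsto_mult_right_zero)
  qed
  have "\<forall>\<^sub>F T in at_top. 0 < T \<and> high_bound T < \<epsilon> \<and> high_sq_bound T < \<epsilon>"
    using order_tendstoD(2)[OF 1 assms] order_tendstoD(2)[OF 2 assms] eventually_gt_at_top[of 0]
    by eventually_elim auto
  from eventually_happens[OF this] show ?thesis by (auto intro: less_imp_le)
qed

text \<open>The inverse temperature is divided inside the exponent. The share \<open>b\<close> is
  expanded into the high-frequency pair energy, whose exponential moment is at most
  \<open>exp 1\<close>; on the share \<open>r\<close> only the pointwise bound \<open>R\<close> is
  used.\<close>

lemma partition_fun_le:
  assumes T: "0 < T" and N: "1 \<le> N" and b: "0 \<le> b" and r: "0 \<le> r"
    and small: "2 * b * high_bound T \<le> 1 / 2" "16 * b\<^sup>2 * high_sq_bound T \<le> 1 / 256"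
    and R: "\<And>X. inj_on X {1..N} \<Longrightarrow> - (real N * modulated_energy s N X \<mu>) \<le> R"
  shows "partition_fun s N (b + r) \<mu>
    \<le> ennreal (exp (r * R + b * ((riesz_low s T (0::'a) + riesz_shift s T) / 2 + high_bound T) + 1))"
proof -
  let ?K = "\<lambda>x y. - b * high_kernel T x y"
  let ?E = "(riesz_low s T (0::'a) + riesz_shift s T) / 2 + high_bound T"
  interpret K: degenerate_kernel \<mu> ?K "1 / 2" "1 / 256"
    by (rule degenerate_high_kernel[OF T b small])
  have "partition_fun s N (b + r) \<mu> \<le> (\<integral>\<^sup>+X. ennreal (exp (r * R + b * ?E))
      * ennreal (exp ((\<Sum>j\<in>{1..N}. \<Sum>i\<in>{1..<j}. ?K (X i) (X j)) / real N)) \<partial>Pi\<^sub>M {1..N} (\<lambda>_. \<mu>))"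
    unfolding partition_fun_def
  proof (rule nn_integral_mono_AE)
    have "AE X in Pi\<^sub>M {1..N} (\<lambda>_. \<mu>). inj_on X {1..N}" by (rule AE_PiM_inj_on) simp
    then show "AE X in Pi\<^sub>M {1..N} (\<lambda>_. \<mu>). ennreal (exp (- (b + r) * real N * modulated_energy s N X \<mu>))
      \<le> ennreal (exp (r * R + b * ?E)) * ennreal (exp ((\<Sum>j\<in>{1..N}. \<Sum>i\<in>{1..<j}. ?K (X i) (X j)) / real N))"
    proof eventually_elim
      case (elim X)
      let ?P = "\<Sum>j\<in>{1..N}. \<Sum>i\<in>{1..<j}. high_kernel T (X i) (X j)"
      have "- (b + r) * real N * modulated_energy s N X \<mu>
          = b * - (real N * modulated_energy s N X \<mu>) + r * - (real N * modulated_energy s N X \<mu>)"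
        by (simp add: algebra_simps)
      also have "\<dots> \<le> b * (?E - ?P / real N) + r * R"
        by (intro add_mono mult_left_mono b r R[OF elim] neg_modulated_energy_le[OF T N elim])
      also have "\<dots> = (r * R + b * ?E) + (\<Sum>j\<in>{1..N}. \<Sum>i\<in>{1..<j}. ?K (X i) (X j)) / real N"
        by (simp add: sum_negf sum_distrib_left[symmetric] algebra_simps)
      finally show ?case by (simp add: exp_add[symmetric] flip: ennreal_mult)
    qed
  qed
  also have "\<dots> = ennreal (exp (r * R + b * ?E))
      * (\<integral>\<^sup>+X. ennreal (exp ((\<Sum>j\<in>{1..N}. \<Sum>i\<in>{1..<j}. ?K (X i) (X j)) / real N)) \<partial>Pi\<^sub>M {1..N} (\<lambda>_. \<mu>))"
  proof (rule nn_integral_cmult)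
    note [measurable] = K.measurable_pair_energy[of N]
    show "(\<lambda>X. ennreal (exp ((\<Sum>j\<in>{1..N}. \<Sum>i\<in>{1..<j}. ?K (X i) (X j)) / real N)))
        \<in> borel_measurable (Pi\<^sub>M {1..N} (\<lambda>_. \<mu>))"
      by measurable
  qed
  also have "\<dots> \<le> ennreal (exp (r * R + b * ?E)) * ennreal (exp 1)"
    by (intro mult_left_mono degenerate_exp_moment[OF K.degenerate_kernel_axioms N]) auto
  also have "\<dots> = ennreal (exp (r * R + b * ?E + 1))"
    by (simp add: exp_add flip: ennreal_mult)
  finally show ?thesis .
qed

theorem partition_fun_bound:
  assumes B: "0 < B"
  shows "\<exists>C\<ge>1. \<forall>\<beta>\<ge>0. \<forall>N\<ge>1. partition_fun s N \<beta> \<mu>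
    \<le> ennreal (C * exp (C * max (\<beta> - B) 0 * energy_rate DIM('a) s N))"
proof -
  obtain R where R: "0 \<le> R"
    "\<And>N X. 1 \<le> N \<Longrightarrow> inj_on X {1..N} \<Longrightarrow> - (real N * modulated_energy s N X \<mu>) \<le> R * energy_rate DIM('a) s N"
    using neg_modulated_energy_rate by blast
  \<comment> \<open>The two entries are what the smallness conditions of
    \<open>degenerate_high_kernel\<close> require at \<open>\<beta> = B\<close>. The resulting
    \<open>T\<close> does not depend on \<open>N\<close>.\<close>
  define \<epsilon> where "\<epsilon> = min (1 / (4 * B)) (1 / (4096 * B\<^sup>2))"
  have \<epsilon>: "0 < \<epsilon>" using B by (simp add: \<epsilon>_def)
  obtain T where T: "0 < T" "high_bound T \<le> \<epsilon>" "high_sq_bound T \<le> \<epsilon>"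
    using high_bounds_small[OF \<epsilon>] by blast
  define E where "E = (riesz_low s T (0::'a) + riesz_shift s T) / 2 + high_bound T"
  \<comment> \<open>One constant serves as prefactor and as rate: the exponential covers the bound
    at \<open>\<beta> \<le> B\<close>, and \<open>R\<close> covers the excess.\<close>
  define C where "C = max R (exp (B * \<bar>E\<bar> + 1))"
  have C1: "exp (B * \<bar>E\<bar> + 1) \<le> C" and CR: "R \<le> C" by (simp_all add: C_def)
  have "1 \<le> exp (B * \<bar>E\<bar> + 1)" using B by simp
  with C1 have "1 \<le> C" by linarith
  moreover have "partition_fun s N \<beta> \<mu> \<le> ennreal (C * exp (C * max (\<beta> - B) 0 * energy_rate DIM('a) s N))"
    if \<beta>: "0 \<le> \<beta>" and N: "1 \<le> N" for \<beta> N
  proof -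
    let ?a = "energy_rate DIM('a) s N"
    define b where "b = min \<beta> B"
    define r where "r = max (\<beta> - B) 0"
    have br: "0 \<le> b" "b \<le> B" "0 \<le> r" "b + r = \<beta>" using \<beta> B by (auto simp: b_def r_def)
    have a: "0 \<le> ?a" using energy_rate_ge_1[OF s_nonneg N, of "DIM('a)"] by linarith
    have "2 * b * high_bound T \<le> 2 * B * (1 / (4 * B))"
      using br B T(2) high_bound_nonneg[of T] by (intro mult_mono) (auto simp: \<epsilon>_def)
    then have small1: "2 * b * high_bound T \<le> 1 / 2" using B by simp
    have "16 * b\<^sup>2 * high_sq_bound T \<le> 16 * B\<^sup>2 * (1 / (4096 * B\<^sup>2))"
      using br B T(3) high_sq_bound_nonneg[of T] by (intro mult_mono power_mono) (auto simp: \<epsilon>_def)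
    then have small2: "16 * b\<^sup>2 * high_sq_bound T \<le> 1 / 256" using B by simp
    have "partition_fun s N \<beta> \<mu> \<le> ennreal (exp (r * (R * ?a) + b * E + 1))"
      using partition_fun_le[OF T(1) N br(1) br(3) small1 small2 R(2)[OF N]] by (simp add: br(4) E_def)
    also have "\<dots> \<le> ennreal (C * exp (C * r * ?a))"
    proof (rule ennreal_leI)
      have "b * E \<le> B * \<bar>E\<bar>" using br B by (intro order_trans[OF mult_left_mono[OF abs_ge_self] mult_right_mono]) auto
      moreover have "R * (r * ?a) \<le> C * (r * ?a)" using br a CR by (intro mult_right_mono) auto
      ultimately have "exp (r * (R * ?a) + b * E + 1) \<le> exp ((B * \<bar>E\<bar> + 1) + C * r * ?a)"
        by (simp add: mult_ac)
      also have "\<dots> = exp (B * \<bar>E\<bar> + 1) * exp (C * r * ?a)" by (rule exp_add)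
      also have "\<dots> \<le> C * exp (C * r * ?a)" by (intro mult_right_mono C1) auto
      finally show "exp (r * (R * ?a) + b * E + 1) \<le> C * exp (C * r * ?a)" .
    qed
    finally show ?thesis by (simp add: r_def)
  qed
  ultimately show ?thesis by blast
qed

end

section \<open>From bounded densities to the final estimates\<close>

lemma bounded_density_prob_imp_riesz_gas:
  fixes s :: real and \<mu> :: "'a::euclidean_space measure"
  assumes "0 \<le> s" "s < real DIM('a) / 2" "bounded_density_prob \<mu>"
    and "s = 0 \<Longrightarrow> (\<integral>\<^sup>+p. ennreal \<bar>ln (norm (fst p - snd p))\<bar> \<partial>(\<mu> \<Otimes>\<^sub>M \<mu>)) < \<infinity>"
  shows "\<exists>D. riesz_gas \<mu> s D"
proof -
  obtain f M where prob: "prob_space \<mu>" and sets: "sets \<mu> = sets borel"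
    and f: "f \<in> borel_measurable lborel" "AE x in lborel. 0 \<le> f x \<and> f x \<le> (M::real)"
    and eq: "\<mu> = density lborel (\<lambda>x. ennreal (f x))"
    using assms(3) unfolding bounded_density_prob_def by blast
  \<comment> \<open>Taking \<open>max 0 M\<close> gives \<open>D_nonneg\<close> at once, without
    deriving the sign of \<open>M\<close> from the almost everywhere bounds.\<close>
  have "riesz_gas \<mu> s (max 0 M)"
  proof (intro riesz_gas.intro riesz_gas_axioms.intro prob sets assms)
    fix g :: "'a \<Rightarrow> ennreal" assume g: "g \<in> borel_measurable borel"
    have "(\<integral>\<^sup>+x. g x \<partial>\<mu>) = (\<integral>\<^sup>+x. ennreal (f x) * g x \<partial>lborel)"
      unfolding eq using f g by (intro nn_integral_density) auto
    also have "\<dots> \<le> (\<integral>\<^sup>+x. ennreal (max 0 M) * g x \<partial>lborel)"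
    proof (rule nn_integral_mono_AE)
      show "AE x in lborel. ennreal (f x) * g x \<le> ennreal (max 0 M) * g x"
        using f(2) by eventually_elim (auto intro!: mult_right_mono ennreal_leI)
    qed
    also have "\<dots> = ennreal (max 0 M) * (\<integral>\<^sup>+x. g x \<partial>lborel)" using g by (intro nn_integral_cmult) auto
    finally show "(\<integral>\<^sup>+x. g x \<partial>\<mu>) \<le> ennreal (max 0 M) * (\<integral>\<^sup>+x. g x \<partial>lborel)" .
  qed auto
  then show ?thesis by blast
qed

theorem corollary5p7:
  fixes s :: real and \<mu> :: "'a::euclidean_space measure"
  assumes "0 \<le> s" and "s < real DIM('a) / 2"
    and "bounded_density_prob \<mu>"
    and "s = 0 \<Longrightarrow> (\<integral>\<^sup>+p. ennreal \<bar>ln (norm (fst p - snd p))\<bar> \<partial>(\<mu> \<Otimes>\<^sub>M \<mu>)) < \<infinity>"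
  shows
    "(\<forall>B>0. \<exists>C::real.
        (SUP N\<in>{1..}. SUP \<beta>\<in>{0..B}. partition_fun s N \<beta> \<mu>) \<le> ennreal C \<and>
        (\<forall>\<beta>\<ge>0. \<forall>N\<ge>1. partition_fun s N \<beta> \<mu>
           \<le> ennreal (C * exp (C * max (\<beta> - B) 0 * energy_rate DIM('a) s N))))
     \<and>
     (\<forall>Bstar>0. \<exists>C::real. \<forall>\<gamma>::real. \<forall>N\<ge>1.
        (SUP \<beta>\<in>{0..Bstar}. log_ennreal (partition_fun s N (\<beta> * real N powr \<gamma>) \<mu>))
          \<le> ereal (if \<gamma> \<le> 0 then C
                    else if s = 0 then C * real N powr \<gamma> * ln (exp 1 + real N)
                    else C * real N powr (\<gamma> + s / real DIM('a))))"
proof -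
  obtain D where "riesz_gas \<mu> s D"
    using bounded_density_prob_imp_riesz_gas[OF assms(1-3)] assms(4) by blast
  then interpret riesz_gas \<mu> s D .
  show ?thesis
  proof (intro conjI allI impI)
    fix B :: real assume B: "0 < B"
    from partition_fun_bound[OF B] obtain C where C: "1 \<le> C" "\<And>\<beta> N. 0 \<le> \<beta> \<Longrightarrow> 1 \<le> N \<Longrightarrow>
        partition_fun s N \<beta> \<mu> \<le> ennreal (C * exp (C * max (\<beta> - B) 0 * energy_rate DIM('a) s N))"
      by blast
    have "partition_fun s N \<beta> \<mu> \<le> ennreal C" if "1 \<le> N" "0 \<le> \<beta>" "\<beta> \<le> B" for N \<beta>
      using C(2)[of \<beta> N] that by simp
    then show "\<exists>C. (SUP N\<in>{1..}. SUP \<beta>\<in>{0..B}. partition_fun s N \<beta> \<mu>) \<le> ennreal C \<and>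
        (\<forall>\<beta>\<ge>0. \<forall>N\<ge>1. partition_fun s N \<beta> \<mu>
           \<le> ennreal (C * exp (C * max (\<beta> - B) 0 * energy_rate DIM('a) s N)))"
      using C(2) by (intro exI[of _ C] conjI SUP_least) auto
  next
    fix B :: real assume B: "0 < B"
    from partition_fun_bound[OF B] obtain C where C: "1 \<le> C" "\<And>\<beta> N. 0 \<le> \<beta> \<Longrightarrow> 1 \<le> N \<Longrightarrow>
        partition_fun s N \<beta> \<mu> \<le> ennreal (C * exp (C * max (\<beta> - B) 0 * energy_rate DIM('a) s N))"
      by blast
    \<comment> \<open>The upper limit for \<open>\<beta>\<close> also serves as the threshold in
      \<open>partition_fun_bound\<close>. For \<open>\<gamma> \<le> 0\<close> the scaled temperature
      stays below it and the excess vanishes; otherwise the excess is at most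
      \<open>B * real N powr \<gamma>\<close>. Hence \<open>C'\<close> depends on neither
      \<open>\<gamma>\<close> nor \<open>N\<close>.\<close>
    define C' where "C' = ln C + C * B"
    have lnC: "0 \<le> ln C" using C(1) by simp
    have "log_ennreal (partition_fun s N (\<beta> * real N powr \<gamma>) \<mu>)
      \<le> ereal (if \<gamma> \<le> 0 then C' else if s = 0 then C' * real N powr \<gamma> * ln (exp 1 + real N)
           else C' * real N powr (\<gamma> + s / real DIM('a)))"
      if N: "1 \<le> N" and \<beta>: "0 \<le> \<beta>" "\<beta> \<le> B" for \<gamma> N \<beta>
    proof -
      let ?a = "energy_rate DIM('a) s N" and ?x = "\<beta> * real N powr \<gamma>"
      have a: "1 \<le> ?a" by (rule energy_rate_ge_1[OF s_nonneg N])
      have "C * exp (C * max (?x - B) 0 * ?a) = exp (ln C + C * max (?x - B) 0 * ?a)"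
        using C(1) by (simp add: exp_add)
      then have log: "log_ennreal (partition_fun s N ?x \<mu>) \<le> ereal (ln C + C * max (?x - B) 0 * ?a)"
        using C(2)[of ?x N] N \<beta> by (intro log_ennreal_le) simp
      show ?thesis
      proof (cases "\<gamma> \<le> 0")
        case True
        then have "real N powr \<gamma> \<le> 1" using N powr_mono[of \<gamma> 0 "real N"] by simp
        then have "?x \<le> B * 1" using \<beta> B by (intro mult_mono) auto
        then have "ln C + C * max (?x - B) 0 * ?a \<le> C'" using C(1) B by (simp add: C'_def)
        with log True show ?thesis by (auto intro: order_trans)
      next
        case False
        have N\<gamma>: "1 \<le> real N powr \<gamma>" using N False by (intro ge_one_powr_ge_zero) auto
        have 1: "1 \<le> real N powr \<gamma> * ?a" using mult_mono[OF N\<gamma> a] a by simp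
        have "max (?x - B) 0 \<le> B * real N powr \<gamma>"
          using \<beta> B mult_right_mono[OF \<beta>(2), of "real N powr \<gamma>"] by auto
        then have "C * max (?x - B) 0 * ?a \<le> C * (B * real N powr \<gamma>) * ?a"
          using C(1) a by (intro mult_right_mono mult_left_mono) auto
        \<comment> \<open>The additive \<open>ln C\<close> is absorbed into the rate, which is at
          least 1; this uses \<open>1 \<le> C\<close>.\<close>
        moreover have "ln C * 1 \<le> ln C * (real N powr \<gamma> * ?a)" by (rule mult_left_mono[OF 1 lnC])
        ultimately have "ln C + C * max (?x - B) 0 * ?a \<le> C' * real N powr \<gamma> * ?a"
          by (simp add: C'_def algebra_simps)
        with log have "log_ennreal (partition_fun s N ?x \<mu>) \<le> ereal (C' * real N powr \<gamma> * ?a)"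
          by (metis ereal_less_eq(3) order_trans)
        then show ?thesis using False by (simp add: energy_rate_def powr_add mult.assoc split: if_splits)
      qed
    qed
    then show "\<exists>C. \<forall>\<gamma>. \<forall>N\<ge>1. (SUP \<beta>\<in>{0..B}. log_ennreal (partition_fun s N (\<beta> * real N powr \<gamma>) \<mu>))
          \<le> ereal (if \<gamma> \<le> 0 then C
                    else if s = 0 then C * real N powr \<gamma> * ln (exp 1 + real N)
                    else C * real N powr (\<gamma> + s / real DIM('a)))"
      by (intro exI[of _ C'] allI impI SUP_least) auto
  qed
qed

end
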